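(* Let $k$ be a field, and let $X$ be the one dimensional projective nonreduced $k$-scheme consisting of a double line in $\mathbb P^2_k$. Let $T$ be any infinite subset of the positive integers $\mathbb Z_+$ such that $\mathbb Z_+\setminus T$ is also infinite. Then there exists a graded linear series $L$ for $\mathcal O_X(2)$ such that, for all positive integers $n$, $$\dim_kL_n= \begin{cases}\lceil \log(n)\rceil &\text{ if }n\in T,\\ \lceil \frac{\log(n)}{2}\rceil&\text{ if }n\not\in T,\end{cases}$$ and $\kappa(L)=-\infty$.
   Context: A double line in $\mathbb P^2_k$ is, in suitable homogeneous coordinates, $X=\mathrm{Proj}(k[x_0,x_1,x_2]/(x_1^2))$. $\log$ is the natural logarithm, and $\lceil x\rceil$ is the smallest integer $n$ with $x\le n$. A graded linear series $L=\bigoplus_{n\ge 0}L_n$ for a line bundle $\mathcal L$ on $X$ is a graded $k$-subalgebra of $\bigoplus_{n\ge 0}\Gamma(X,\mathcal L^n)$. Let $\sigma(L)$ be the maximal $m$ such that there exist $y_1,\ldots,y_m\in L$ which are homogeneous of positive degree and algebraically independent over $k$. The Kodaira-Iitaka dimension is $\kappa(L)=\sigma(L)-1$ if $\sigma(L)>0$, and $\kappa(L)=-\infty$ if $\sigma(L)=0$. *)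

theory Defs
  imports
    Complex_Main
    "HOL-Algebra.Algebra"
    "HOL-Library.Poly_Mapping"
    "HOL-Library.Numeral_Type"
    "HOL-Library.Extended_Real"
begin

section \<open>Graded algebras\<close>

text \<open>
  A graded algebra over a field \<open>'k\<close>: a ring together with its homogeneous components and the
  structure map from \<open>'k\<close>. The record only carries the data; the algebras constructed below are
  commutative rings and the direct sums of their components.
\<close>

record ('k, 'a) graded_algebra = "'a ring" +
  hcomp :: "nat \<Rightarrow> 'a set"
  scal :: "'k \<Rightarrow> 'a"

definition homogeneous :: "('k, 'a, 'z) graded_algebra_scheme \<Rightarrow> 'a set" where
  "homogeneous S = (\<Union>d. hcomp S d)"

definition homogeneous_ideal :: "('k, 'a, 'z) graded_algebra_scheme \<Rightarrow> 'a set \<Rightarrow> bool" where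
  "homogeneous_ideal S J \<longleftrightarrow> ideal J S \<and> J = genideal S (J \<inter> homogeneous S)"

definition irrelevant_ideal :: "('k, 'a, 'z) graded_algebra_scheme \<Rightarrow> 'a set" where
  "irrelevant_ideal S = genideal S (\<Union>d\<in>{0<..}. hcomp S d)"

definition quotient_algebra ::
    "('k, 'a, 'z) graded_algebra_scheme \<Rightarrow> 'a set \<Rightarrow> ('k, 'a set) graded_algebra" where
  "quotient_algebra S I =
    \<lparr> carrier = carrier (S Quot I), monoid.mult = monoid.mult (S Quot I), one = monoid.one (S Quot I),
      ring.zero = ring.zero (S Quot I), ring.add = ring.add (S Quot I),
      hcomp = (\<lambda>d. (\<lambda>f. I +>\<^bsub>S\<^esub> f) ` hcomp S d),
      scal = (\<lambda>c. I +>\<^bsub>S\<^esub> scal S c) \<rparr>"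

text \<open>
  In \<open>('v \<Rightarrow>\<^sub>0 nat) \<Rightarrow>\<^sub>0 'k\<close> the elements of \<open>'v \<Rightarrow>\<^sub>0 nat\<close> are the exponents of monomials in
  variables indexed by \<open>'v\<close>; the type class multiplication is convolution.
\<close>

definition polynomial_algebra :: "('k::field, ('v \<Rightarrow>\<^sub>0 nat) \<Rightarrow>\<^sub>0 'k) graded_algebra" where
  "polynomial_algebra =
    \<lparr> carrier = UNIV, monoid.mult = (*), one = 1, ring.zero = 0, ring.add = (+),
      hcomp = (\<lambda>d. {f. \<forall>e\<in>Poly_Mapping.keys f.
                      (\<Sum>i\<in>Poly_Mapping.keys e. Poly_Mapping.lookup e i) = d}),
      scal = (\<lambda>c. Poly_Mapping.single 0 c) \<rparr>"

definition poly_var :: "'v \<Rightarrow> ('v \<Rightarrow>\<^sub>0 nat) \<Rightarrow>\<^sub>0 'k::field" where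
  "poly_var i = Poly_Mapping.single (Poly_Mapping.single i 1) 1"

text \<open>The homogeneous coordinate ring \<open>k[x\<^sub>0, x\<^sub>1, x\<^sub>2] / (x\<^sub>1\<^sup>2)\<close> of the double line; the type \<open>3\<close>
  has the elements \<open>0\<close>, \<open>1\<close> and \<open>2\<close>.\<close>

definition double_line_ring :: "('k::field, ((3 \<Rightarrow>\<^sub>0 nat) \<Rightarrow>\<^sub>0 'k) set) graded_algebra" where
  "double_line_ring =
    quotient_algebra polynomial_algebra (genideal polynomial_algebra {(poly_var 1)\<^sup>2})"


section \<open>Localization\<close>

text \<open>\<open>fraction R M a s\<close> is the class of all \<open>(b, t)\<close> with \<open>b / t = a / s\<close> in \<open>M\<^sup>-\<^sup>1 R\<close>. The operations
  on classes do not depend on the representatives, so that the unions below are unions of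
  identical classes.\<close>

definition fraction :: "('a, 'z) ring_scheme \<Rightarrow> 'a set \<Rightarrow> 'a \<Rightarrow> 'a \<Rightarrow> ('a \<times> 'a) set" where
  "fraction R M a s = {(b, t). b \<in> carrier R \<and> t \<in> M \<and>
     (\<exists>u\<in>M. u \<otimes>\<^bsub>R\<^esub> (a \<otimes>\<^bsub>R\<^esub> t \<ominus>\<^bsub>R\<^esub> b \<otimes>\<^bsub>R\<^esub> s) = \<zero>\<^bsub>R\<^esub>)}"

definition localization :: "('a, 'z) ring_scheme \<Rightarrow> 'a set \<Rightarrow> ('a \<times> 'a) set ring" where
  "localization R M =
    \<lparr> carrier = {fraction R M a s | a s. a \<in> carrier R \<and> s \<in> M},
      monoid.mult = (\<lambda>C D. \<Union>(a, s)\<in>C. \<Union>(b, t)\<in>D. fraction R M (a \<otimes>\<^bsub>R\<^esub> b) (s \<otimes>\<^bsub>R\<^esub> t)),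
      one = fraction R M \<one>\<^bsub>R\<^esub> \<one>\<^bsub>R\<^esub>,
      ring.zero = fraction R M \<zero>\<^bsub>R\<^esub> \<one>\<^bsub>R\<^esub>,
      ring.add = (\<lambda>C D. \<Union>(a, s)\<in>C. \<Union>(b, t)\<in>D.
               fraction R M (a \<otimes>\<^bsub>R\<^esub> t \<oplus>\<^bsub>R\<^esub> b \<otimes>\<^bsub>R\<^esub> s) (s \<otimes>\<^bsub>R\<^esub> t)) \<rparr>"


section \<open>Proj and its twisting sheaves\<close>

definition Proj :: "('k, 'a, 'z) graded_algebra_scheme \<Rightarrow> 'a set set" where
  "Proj S = {P. primeideal P S \<and> homogeneous_ideal S P \<and> \<not> irrelevant_ideal S \<subseteq> P}"

definition zariski_open :: "('k, 'a, 'z) graded_algebra_scheme \<Rightarrow> 'a set set \<Rightarrow> bool" where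
  "zariski_open S U \<longleftrightarrow> (\<exists>J. homogeneous_ideal S J \<and> U = {P \<in> Proj S. \<not> J \<subseteq> P})"

text \<open>The localization of \<open>S\<close> at the homogeneous elements outside \<open>P\<close>. Its elements of degree \<open>n\<close>
  form the stalk at \<open>P\<close> of the sheaf \<open>O(n)\<close>; those of degree \<open>0\<close> form the local ring.\<close>

abbreviation homogeneous_localization ::
    "('k, 'a, 'z) graded_algebra_scheme \<Rightarrow> 'a set \<Rightarrow> ('a \<times> 'a) set ring" where
  "homogeneous_localization S P \<equiv> localization S (homogeneous S - P)"

abbreviation homogeneous_fraction ::
    "('k, 'a, 'z) graded_algebra_scheme \<Rightarrow> 'a set \<Rightarrow> 'a \<Rightarrow> 'a \<Rightarrow> ('a \<times> 'a) set" where
  "homogeneous_fraction S P \<equiv> fraction S (homogeneous S - P)"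

definition twist_stalk ::
    "('k, 'a, 'z) graded_algebra_scheme \<Rightarrow> nat \<Rightarrow> 'a set \<Rightarrow> ('a \<times> 'a) set set" where
  "twist_stalk S n P =
    {homogeneous_fraction S P a s | a s d. a \<in> hcomp S (d + n) \<and> s \<in> hcomp S d - P}"

text \<open>The sections of \<open>O(n)\<close> over the open set \<open>U\<close>: families of germs that are locally given by a
  single fraction of degree \<open>n\<close>.\<close>

definition twist_sections ::
    "('k, 'a, 'z) graded_algebra_scheme \<Rightarrow> nat \<Rightarrow> 'a set set \<Rightarrow> ('a set \<Rightarrow> ('a \<times> 'a) set) set" where
  "twist_sections S n U =
    {f \<in> (\<Pi>\<^sub>E P\<in>U. twist_stalk S n P).
      \<forall>P\<in>U. \<exists>V a s d. zariski_open S V \<and> P \<in> V \<and> V \<subseteq> U \<and> a \<in> hcomp S (d + n) \<and> s \<in> hcomp S d \<and>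
        (\<forall>Q\<in>V. s \<notin> Q \<and> f Q = homogeneous_fraction S Q a s)}"

text \<open>The zero section. It is the same function for every twist.\<close>

definition zero_section ::
    "('k, 'a, 'z) graded_algebra_scheme \<Rightarrow> 'a set \<Rightarrow> ('a \<times> 'a) set" where
  "zero_section S = (\<lambda>P\<in>Proj S. \<zero>\<^bsub>homogeneous_localization S P\<^esub>)"

text \<open>
  The graded algebra \<open>\<Oplus>\<^sub>n \<Gamma>(X, O\<^sub>X(d)\<^sup>n)\<close> for \<open>X = Proj S\<close>, where \<open>S\<close> is generated in degree \<open>1\<close>, so
  that \<open>O\<^sub>X(d)\<^sup>n = O\<^sub>X(d n)\<close>. An element \<open>y\<close> is a finitely supported family with \<open>y n\<close> in the \<open>n\<close>-th
  summand. A product of sections is the pointwise product of their germs.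
\<close>

definition section_algebra ::
    "('k, 'a, 'z) graded_algebra_scheme \<Rightarrow> nat \<Rightarrow>
     ('k, nat \<Rightarrow> 'a set \<Rightarrow> ('a \<times> 'a) set) graded_algebra" where
  "section_algebra S d =
    (let A = {y. (\<forall>n. y n \<in> twist_sections S (d * n) (Proj S)) \<and> finite {n. y n \<noteq> zero_section S}};
         const = (\<lambda>c n. if n = 0 then \<lambda>P\<in>Proj S. homogeneous_fraction S P c \<one>\<^bsub>S\<^esub> else zero_section S)
     in \<lparr> carrier = A,
          monoid.mult = (\<lambda>y z n. \<lambda>P\<in>Proj S.
            finsum (homogeneous_localization S P)
              (\<lambda>i. y i P \<otimes>\<^bsub>homogeneous_localization S P\<^esub> z (n - i) P) {..n}),
          one = const \<one>\<^bsub>S\<^esub>,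
          ring.zero = (\<lambda>n. zero_section S),
          ring.add = (\<lambda>y z n. \<lambda>P\<in>Proj S. y n P \<oplus>\<^bsub>homogeneous_localization S P\<^esub> z n P),
          hcomp = (\<lambda>n. {y \<in> A. \<forall>m. m \<noteq> n \<longrightarrow> y m = zero_section S}),
          scal = (\<lambda>c. const (scal S c)) \<rparr>)"


section \<open>Graded linear series and their Kodaira-Iitaka dimension\<close>

definition graded_subalgebra :: "('k, 'a, 'z) graded_algebra_scheme \<Rightarrow> 'a set \<Rightarrow> bool" where
  "graded_subalgebra A L \<longleftrightarrow>
    subring L A \<and> range (scal A) \<subseteq> L \<and>
    (\<forall>y\<in>L. \<exists>z N. (\<forall>n. z n \<in> L \<inter> hcomp A n) \<and> y = finsum A z {..(N::nat)})"

text \<open>Graded linear series for \<open>O\<^sub>X(d)\<close> on \<open>X = Proj S\<close>.\<close>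

definition graded_linear_series ::
    "('k, 'a, 'z) graded_algebra_scheme \<Rightarrow> nat \<Rightarrow> (nat \<Rightarrow> 'a set \<Rightarrow> ('a \<times> 'a) set) set \<Rightarrow> bool" where
  "graded_linear_series S d L \<longleftrightarrow> graded_subalgebra (section_algebra S d) L"

text \<open>\<open>V\<close> is a \<open>k\<close>-subspace of dimension \<open>n\<close>, where \<open>k\<close> acts through its image in \<open>A\<close>.\<close>

definition has_dim :: "('k, 'a, 'z) graded_algebra_scheme \<Rightarrow> 'a set \<Rightarrow> nat \<Rightarrow> bool" where
  "has_dim A V n \<longleftrightarrow> ring.dimension A n (range (scal A)) V"

definition eval_poly ::
    "('k::field, 'a, 'z) graded_algebra_scheme \<Rightarrow> nat \<Rightarrow> (nat \<Rightarrow> 'a) \<Rightarrow> ((nat \<Rightarrow>\<^sub>0 nat) \<Rightarrow>\<^sub>0 'k) \<Rightarrow> 'a" where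
  "eval_poly A m y F =
    finsum A (\<lambda>e. scal A (Poly_Mapping.lookup F e) \<otimes>\<^bsub>A\<^esub>
        finprod A (\<lambda>i. y i [^]\<^bsub>A\<^esub> Poly_Mapping.lookup e i) {..<m})
      (Poly_Mapping.keys F)"

text \<open>Algebraic independence over \<open>k\<close> of \<open>y 0, \<dots>, y (m - 1)\<close>.\<close>

definition algebraically_independent ::
    "('k::field, 'a, 'z) graded_algebra_scheme \<Rightarrow> nat \<Rightarrow> (nat \<Rightarrow> 'a) \<Rightarrow> bool" where
  "algebraically_independent A m y \<longleftrightarrow>
    (\<forall>F. (\<forall>e\<in>Poly_Mapping.keys F. Poly_Mapping.keys e \<subseteq> {..<m}) \<and> eval_poly A m y F = \<zero>\<^bsub>A\<^esub>
      \<longrightarrow> F = 0)"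

text \<open>The supremum is the maximum whenever the set of such \<open>m\<close> is bounded; \<open>m = 0\<close> is always allowed.\<close>

definition sigma :: "('k::field, 'a, 'z) graded_algebra_scheme \<Rightarrow> 'a set \<Rightarrow> enat" where
  "sigma A L = Sup {enat m | m. \<exists>y. (\<forall>i<m. \<exists>n>0. y i \<in> L \<inter> hcomp A n) \<and>
                                algebraically_independent A m y}"

definition kodaira_iitaka_dim :: "('k::field, 'a, 'z) graded_algebra_scheme \<Rightarrow> 'a set \<Rightarrow> ereal" where
  "kodaira_iitaka_dim A L =
    (if sigma A L > 0 then ereal_of_enat (sigma A L) - 1 else - \<infinity>)"

end

theory Submission
  imports Defs
begin

text \<open>
  On the double line, \<open>x\<^sub>1\<close> is a nilpotent coordinate. The forms of degree \<open>2 n\<close> in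
  \<open>k[x\<^sub>0, x\<^sub>1, x\<^sub>2] / (x\<^sub>1\<^sup>2)\<close> that are multiples of \<open>x\<^sub>1\<close> make up a space of dimension \<open>2 n\<close>, with the basis
  \<open>x\<^sub>0\<^sup>i x\<^sub>1 x\<^sub>2\<^sup>m\<close>, \<open>i + m = 2 n - 1\<close>, and the product of any two of them is zero. Hence the constants together
  with an arbitrary choice of a subspace of this space for each \<open>n > 0\<close> form a graded subalgebra, and
  its dimensions can be prescribed freely up to the bound \<open>2 n\<close>, which exceeds the logarithm of \<open>n\<close>
  (\<open>square_zero_series_exists\<close>). Its homogeneous elements of positive degree square to zero, so
  not even one of them is algebraically independent (\<open>kodaira_iitaka_dim_nilpotent\<close>).

  To turn this into a statement about sections of \<open>O(2 n)\<close> on \<open>Proj\<close>, two facts are needed. The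
  algebra of sections is a commutative ring: it embeds into a product of polynomial rings over the
  rings of germs (\<open>cring_section_algebra\<close>), and these are localizations (\<open>cring_localization\<close>). And
  forms that are linearly independent stay so as sections: already the germ at the generic point
  \<open>(x\<^sub>1)\<close> determines a form, because the denominators at this point are not divisible by \<open>x\<^sub>1\<close>, so they
  act injectively modulo \<open>x\<^sub>1\<^sup>2\<close> (\<open>global_section_residue_class_inject\<close>). The dimension is then
  computed by adding one monomial at a time (\<open>has_dim_chain\<close>).
\<close>

section \<open>Localization\<close>

text \<open>
  The operations on fractions are unions over all pairs of representatives; such a union is computed
  from any one pair as soon as its terms do not depend on the representatives.
\<close>

lemma UN_pairs_const:
  assumes "C \<noteq> {}" "D \<noteq> {}"
    and "\<And>a s b t. (a, s) \<in> C \<Longrightarrow> (b, t) \<in> D \<Longrightarrow> F a s b t = E"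
  shows "(\<Union>(a, s)\<in>C. \<Union>(b, t)\<in>D. F a s b t) = E"
proof -
  have "(\<Union>(b, t)\<in>D. F a s b t) = E" if "(a, s) \<in> C" for a s
  proof -
    have "(\<Union>(b, t)\<in>D. F a s b t) = (\<Union>_\<in>D. E)"
      by (rule SUP_cong) (auto simp: assms(3)[OF that])
    then show ?thesis using assms(2) by simp
  qed
  then have "(\<Union>(a, s)\<in>C. \<Union>(b, t)\<in>D. F a s b t) = (\<Union>_\<in>C. E)"
    by (intro SUP_cong refl) clarsimp
  then show ?thesis using assms(1) by simp
qed

locale localization_data = cring R + submonoid M R for R (structure) and M
begin

lemma M_carrier [simp]: "s \<in> M \<Longrightarrow> s \<in> carrier R"
  using subset by blast

lemma mem_fraction:
  assumes "a \<in> carrier R" "s \<in> M"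
  shows "(b, t) \<in> fraction R M a s \<longleftrightarrow>
    b \<in> carrier R \<and> t \<in> M \<and> (\<exists>u\<in>M. u \<otimes> (a \<otimes> t) = u \<otimes> (b \<otimes> s))"
proof -
  have "u \<otimes> (a \<otimes> t \<ominus> b \<otimes> s) = \<zero> \<longleftrightarrow> u \<otimes> (a \<otimes> t) = u \<otimes> (b \<otimes> s)"
    if "b \<in> carrier R" "t \<in> M" "u \<in> M" for u
  proof -
    have "u \<otimes> (a \<otimes> t \<ominus> b \<otimes> s) = u \<otimes> (a \<otimes> t) \<ominus> u \<otimes> (b \<otimes> s)"
      using that assms by (simp add: a_minus_def r_distr r_minus)
    then show ?thesis
      using that assms by (simp add: r_right_minus_eq)
  qed
  then show ?thesis
    unfolding fraction_def by auto
qed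

lemma fraction_self: "a \<in> carrier R \<Longrightarrow> s \<in> M \<Longrightarrow> (a, s) \<in> fraction R M a s"
  using one_closed by (auto simp: mem_fraction)

text \<open>
  If \<open>u\<close> witnesses \<open>a / s = b / t\<close> and \<open>v\<close> witnesses \<open>a / s = c / r\<close>, then \<open>u v s\<close> witnesses
  \<open>b / t = c / r\<close>: the factor \<open>s\<close> is the common denominator that has to be cleared.
\<close>

lemma fraction_eqI:
  assumes "a \<in> carrier R" "s \<in> M" "b \<in> carrier R" "t \<in> M" "u \<in> M"
    and eq: "u \<otimes> (a \<otimes> t) = u \<otimes> (b \<otimes> s)"
  shows "fraction R M a s = fraction R M b t"
proof -
  have sub: "(c, r) \<in> fraction R M b t"
    if abst: "a \<in> carrier R" "s \<in> M" "b \<in> carrier R" "t \<in> M"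
      and eq: "u \<otimes> (a \<otimes> t) = u \<otimes> (b \<otimes> s)" and cr: "(c, r) \<in> fraction R M a s" for a s b t c r
  proof -
    obtain v where v: "c \<in> carrier R" "r \<in> M" "v \<in> M" "v \<otimes> (a \<otimes> r) = v \<otimes> (c \<otimes> s)"
      using cr abst by (auto simp: mem_fraction)
    have "(u \<otimes> v \<otimes> s) \<otimes> (b \<otimes> r) = (u \<otimes> (b \<otimes> s)) \<otimes> (v \<otimes> r)"
      using abst v \<open>u \<in> M\<close> by (simp add: m_ac)
    also have "\<dots> = (v \<otimes> (a \<otimes> r)) \<otimes> (u \<otimes> t)"
      unfolding eq[symmetric] using abst v(1-3) \<open>u \<in> M\<close> by (simp add: m_ac)
    also have "\<dots> = (u \<otimes> v \<otimes> s) \<otimes> (c \<otimes> t)"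
      unfolding v(4) using abst v(1-3) \<open>u \<in> M\<close> by (simp add: m_ac)
    finally show ?thesis
      using abst v \<open>u \<in> M\<close> by (auto simp: mem_fraction intro!: bexI[of _ "u \<otimes> v \<otimes> s"])
  qed
  show ?thesis
    using sub[of a s b t] sub[of b t a s] assms by auto
qed

lemma fraction_eq_iff:
  assumes "a \<in> carrier R" "s \<in> M" "b \<in> carrier R" "t \<in> M"
  shows "fraction R M a s = fraction R M b t \<longleftrightarrow> (\<exists>u\<in>M. u \<otimes> (a \<otimes> t) = u \<otimes> (b \<otimes> s))"
  using fraction_self[of b t] mem_fraction[of a s b t] fraction_eqI[of a s b t] assms by blast

lemma localization_carrierE:
  assumes "x \<in> carrier (localization R M)"
  obtains a s where "a \<in> carrier R" "s \<in> M" "x = fraction R M a s"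
  using assms by (auto simp: localization_def)

lemma fraction_in_localization:
  "a \<in> carrier R \<Longrightarrow> s \<in> M \<Longrightarrow> fraction R M a s \<in> carrier (localization R M)"
  by (auto simp: localization_def)

lemma mult_fraction:
  assumes "a \<in> carrier R" "s \<in> M" "b \<in> carrier R" "t \<in> M"
  shows "fraction R M a s \<otimes>\<^bsub>localization R M\<^esub> fraction R M b t = fraction R M (a \<otimes> b) (s \<otimes> t)"
proof -
  have "fraction R M (a' \<otimes> b') (s' \<otimes> t') = fraction R M (a \<otimes> b) (s \<otimes> t)"
    if *: "(a', s') \<in> fraction R M a s" "(b', t') \<in> fraction R M b t" for a' b' s' t'
  proof -
    obtain u where u: "a' \<in> carrier R" "s' \<in> M" "u \<in> M" "u \<otimes> (a \<otimes> s') = u \<otimes> (a' \<otimes> s)"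
      using * assms by (auto simp: mem_fraction)
    obtain v where v: "b' \<in> carrier R" "t' \<in> M" "v \<in> M" "v \<otimes> (b \<otimes> t') = v \<otimes> (b' \<otimes> t)"
      using * assms by (auto simp: mem_fraction)
    have "(u \<otimes> v) \<otimes> ((a' \<otimes> b') \<otimes> (s \<otimes> t)) = (u \<otimes> (a' \<otimes> s)) \<otimes> (v \<otimes> (b' \<otimes> t))"
      using assms u v by (simp add: m_ac)
    also have "\<dots> = (u \<otimes> v) \<otimes> ((a \<otimes> b) \<otimes> (s' \<otimes> t'))"
      unfolding u(4)[symmetric] v(4)[symmetric] using assms u(1-3) v(1-3) by (simp add: m_ac)
    finally show ?thesis
      using assms u v by (intro fraction_eqI[where u = "u \<otimes> v"]) auto
  qed
  then have "(\<Union>(a', s')\<in>fraction R M a s. \<Union>(b', t')\<in>fraction R M b t. fraction R M (a' \<otimes> b') (s' \<otimes> t'))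
      = fraction R M (a \<otimes> b) (s \<otimes> t)"
    using fraction_self[of a s] fraction_self[of b t] assms by (intro UN_pairs_const) blast+
  then show ?thesis
    by (simp add: localization_def)
qed

lemma add_fraction:
  assumes "a \<in> carrier R" "s \<in> M" "b \<in> carrier R" "t \<in> M"
  shows "fraction R M a s \<oplus>\<^bsub>localization R M\<^esub> fraction R M b t
    = fraction R M (a \<otimes> t \<oplus> b \<otimes> s) (s \<otimes> t)"
proof -
  have "fraction R M (a' \<otimes> t' \<oplus> b' \<otimes> s') (s' \<otimes> t') = fraction R M (a \<otimes> t \<oplus> b \<otimes> s) (s \<otimes> t)"
    if *: "(a', s') \<in> fraction R M a s" "(b', t') \<in> fraction R M b t" for a' b' s' t'
  proof -
    obtain u where u: "a' \<in> carrier R" "s' \<in> M" "u \<in> M" "u \<otimes> (a \<otimes> s') = u \<otimes> (a' \<otimes> s)"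
      using * assms by (auto simp: mem_fraction)
    obtain v where v: "b' \<in> carrier R" "t' \<in> M" "v \<in> M" "v \<otimes> (b \<otimes> t') = v \<otimes> (b' \<otimes> t)"
      using * assms by (auto simp: mem_fraction)
    have "(u \<otimes> v) \<otimes> ((a' \<otimes> t' \<oplus> b' \<otimes> s') \<otimes> (s \<otimes> t))
        = (u \<otimes> (a' \<otimes> s)) \<otimes> (v \<otimes> t \<otimes> t') \<oplus> (v \<otimes> (b' \<otimes> t)) \<otimes> (u \<otimes> s \<otimes> s')"
      using assms u v by (simp add: m_ac l_distr r_distr)
    also have "\<dots> = (u \<otimes> v) \<otimes> ((a \<otimes> t \<oplus> b \<otimes> s) \<otimes> (s' \<otimes> t'))"
      unfolding u(4)[symmetric] v(4)[symmetric] using assms u(1-3) v(1-3)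
      by (simp add: m_ac l_distr r_distr)
    finally show ?thesis
      using assms u v by (intro fraction_eqI[where u = "u \<otimes> v"]) auto
  qed
  then have "(\<Union>(a', s')\<in>fraction R M a s. \<Union>(b', t')\<in>fraction R M b t. 
        fraction R M (a' \<otimes> t' \<oplus> b' \<otimes> s') (s' \<otimes> t'))
      = fraction R M (a \<otimes> t \<oplus> b \<otimes> s) (s \<otimes> t)"
    using fraction_self[of a s] fraction_self[of b t] assms by (intro UN_pairs_const) blast+
  then show ?thesis
    by (simp add: localization_def)
qed

lemma zero_localization: "\<zero>\<^bsub>localization R M\<^esub> = fraction R M \<zero> \<one>"
  and one_localization: "\<one>\<^bsub>localization R M\<^esub> = fraction R M \<one> \<one>"
  by (simp_all add: localization_def)

lemma fraction_zero: "s \<in> M \<Longrightarrow> fraction R M \<zero> s = \<zero>\<^bsub>localization R M\<^esub>"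
  unfolding zero_localization by (rule fraction_eqI[where u = \<one>]) auto

lemma cring_localization: "cring (localization R M)"
proof (rule cringI)
  note frac = fraction_in_localization zero_localization one_localization
    mult_fraction add_fraction
  show "abelian_group (localization R M)"
  proof (rule abelian_groupI)
    fix x y assume "x \<in> carrier (localization R M)" "y \<in> carrier (localization R M)"
    then show "x \<oplus>\<^bsub>localization R M\<^esub> y \<in> carrier (localization R M)"
      by (elim localization_carrierE) (simp add: frac)
  next
    show "\<zero>\<^bsub>localization R M\<^esub> \<in> carrier (localization R M)"
      by (simp add: frac)
  next
    fix x y z
    assume "x \<in> carrier (localization R M)" "y \<in> carrier (localization R M)"
      "z \<in> carrier (localization R M)"
    then show "x \<oplus>\<^bsub>localization R M\<^esub> y \<oplus>\<^bsub>localization R M\<^esub> z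
        = x \<oplus>\<^bsub>localization R M\<^esub> (y \<oplus>\<^bsub>localization R M\<^esub> z)"
      by (elim localization_carrierE) (simp add: frac m_ac a_ac l_distr r_distr)
  next
    fix x y assume "x \<in> carrier (localization R M)" "y \<in> carrier (localization R M)"
    then show "x \<oplus>\<^bsub>localization R M\<^esub> y = y \<oplus>\<^bsub>localization R M\<^esub> x"
      by (elim localization_carrierE) (simp add: frac m_ac a_ac)
  next
    fix x assume "x \<in> carrier (localization R M)"
    then show "\<zero>\<^bsub>localization R M\<^esub> \<oplus>\<^bsub>localization R M\<^esub> x = x"
      by (elim localization_carrierE) (simp add: frac)
  next
    fix x assume "x \<in> carrier (localization R M)"
    then obtain a s where x: "a \<in> carrier R" "s \<in> M" "x = fraction R M a s"
      by (rule localization_carrierE)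
    have "fraction R M (\<ominus> a) s \<oplus>\<^bsub>localization R M\<^esub> x = \<zero>\<^bsub>localization R M\<^esub>"
      using x by (simp add: add_fraction l_minus l_neg fraction_zero)
    then show "\<exists>y\<in>carrier (localization R M). y \<oplus>\<^bsub>localization R M\<^esub> x = \<zero>\<^bsub>localization R M\<^esub>"
      using x by (intro bexI[of _ "fraction R M (\<ominus> a) s"]) (auto intro: fraction_in_localization)
  qed
  show "comm_monoid (localization R M)"
  proof (rule comm_monoidI)
    fix x y assume "x \<in> carrier (localization R M)" "y \<in> carrier (localization R M)"
    then show "x \<otimes>\<^bsub>localization R M\<^esub> y \<in> carrier (localization R M)"
      by (elim localization_carrierE) (simp add: frac)
  next
    show "\<one>\<^bsub>localization R M\<^esub> \<in> carrier (localization R M)"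
      by (simp add: frac)
  next
    fix x y z
    assume "x \<in> carrier (localization R M)" "y \<in> carrier (localization R M)"
      "z \<in> carrier (localization R M)"
    then show "x \<otimes>\<^bsub>localization R M\<^esub> y \<otimes>\<^bsub>localization R M\<^esub> z
        = x \<otimes>\<^bsub>localization R M\<^esub> (y \<otimes>\<^bsub>localization R M\<^esub> z)"
      by (elim localization_carrierE) (simp add: frac m_ac)
  next
    fix x assume "x \<in> carrier (localization R M)"
    then show "\<one>\<^bsub>localization R M\<^esub> \<otimes>\<^bsub>localization R M\<^esub> x = x"
      by (elim localization_carrierE) (simp add: frac)
  next
    fix x y assume "x \<in> carrier (localization R M)" "y \<in> carrier (localization R M)"
    then show "x \<otimes>\<^bsub>localization R M\<^esub> y = y \<otimes>\<^bsub>localization R M\<^esub> x"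
      by (elim localization_carrierE) (simp add: frac m_ac)
  qed
  fix x y z
  assume "x \<in> carrier (localization R M)" "y \<in> carrier (localization R M)"
    "z \<in> carrier (localization R M)"
  then obtain a s b t c r where
      a: "a \<in> carrier R" "s \<in> M" "x = fraction R M a s"
      and b: "b \<in> carrier R" "t \<in> M" "y = fraction R M b t"
      and c: "c \<in> carrier R" "r \<in> M" "z = fraction R M c r"
    by (elim localization_carrierE) blast
  \<comment> \<open>The two sides have denominators \<open>s t r\<close> and \<open>s t r\<^sup>2\<close>.\<close>
  have "fraction R M ((a \<otimes> t \<oplus> b \<otimes> s) \<otimes> c) (s \<otimes> t \<otimes> r)
      = fraction R M ((a \<otimes> c) \<otimes> (t \<otimes> r) \<oplus> (b \<otimes> c) \<otimes> (s \<otimes> r)) ((s \<otimes> r) \<otimes> (t \<otimes> r))"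
    using a b c by (intro fraction_eqI[where u = \<one>]) (auto simp: m_ac l_distr r_distr)
  then show "(x \<oplus>\<^bsub>localization R M\<^esub> y) \<otimes>\<^bsub>localization R M\<^esub> z
      = x \<otimes>\<^bsub>localization R M\<^esub> z \<oplus>\<^bsub>localization R M\<^esub> y \<otimes>\<^bsub>localization R M\<^esub> z"
    using a b c by (simp add: frac)
qed

lemma fraction_one_ring_hom: "(\<lambda>a. fraction R M a \<one>) \<in> ring_hom R (localization R M)"
  by (rule ring_hom_memI)
    (auto simp: fraction_in_localization mult_fraction add_fraction one_localization)

end

section \<open>Open sets and sections\<close>

locale graded_comm_algebra = cring S
  for S :: "('k::field, 'a, 'z) graded_algebra_scheme" (structure) +
  assumes hcomp_carrier: "a \<in> hcomp S n \<Longrightarrow> a \<in> carrier S"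
    and hcomp_zero: "\<zero> \<in> hcomp S n"
    and hcomp_add: "a \<in> hcomp S n \<Longrightarrow> b \<in> hcomp S n \<Longrightarrow> a \<oplus> b \<in> hcomp S n"
    and hcomp_neg: "a \<in> hcomp S n \<Longrightarrow> \<ominus> a \<in> hcomp S n"
    and hcomp_mult: "a \<in> hcomp S m \<Longrightarrow> b \<in> hcomp S n \<Longrightarrow> a \<otimes> b \<in> hcomp S (m + n)"
    and hcomp_one: "\<one> \<in> hcomp S 0"
    and scal_hcomp: "scal S c \<in> hcomp S 0"
    and scal_add: "scal S (c + c') = scal S c \<oplus> scal S c'"
    and scal_mult: "scal S (c * c') = scal S c \<otimes> scal S c'"
    and scal_one: "scal S 1 = \<one>"
begin

abbreviation R\<^sub>P :: "'a set \<Rightarrow> ('a \<times> 'a) set ring" where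
  "R\<^sub>P \<equiv> homogeneous_localization S"

abbreviation germ :: "'a set \<Rightarrow> 'a \<Rightarrow> 'a \<Rightarrow> ('a \<times> 'a) set" where
  "germ \<equiv> homogeneous_fraction S"

lemma homogeneousI: "a \<in> hcomp S n \<Longrightarrow> a \<in> homogeneous S"
  by (auto simp: homogeneous_def)

lemma homogeneous_carrier: "a \<in> homogeneous S \<Longrightarrow> a \<in> carrier S"
  by (auto simp: homogeneous_def intro: hcomp_carrier)

lemma homogeneous_mult: "a \<in> homogeneous S \<Longrightarrow> b \<in> homogeneous S \<Longrightarrow> a \<otimes> b \<in> homogeneous S"
  unfolding homogeneous_def using hcomp_mult by blast

lemma Proj_primeideal: "P \<in> Proj S \<Longrightarrow> primeideal P S"
  by (simp add: Proj_def)

lemma one_notin_Proj: "P \<in> Proj S \<Longrightarrow> \<one> \<notin> P"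
  using Proj_primeideal[of P] ideal.one_imp_carrier[of P S] primeideal.I_notcarr[of P S]
    primeideal.axioms(1)[of P S] by blast

text \<open>
  A homogeneous element outside a prime \<open>P\<close> may be used as a denominator at \<open>P\<close>, and products of such
  elements stay homogeneous and, by primeness, outside \<open>P\<close>.
\<close>

lemma Proj_localization_data:
  assumes "P \<in> Proj S"
  shows "localization_data S (homogeneous S - P)"
proof -
  interpret primeideal P S using assms by (rule Proj_primeideal)
  show ?thesis
  proof (intro localization_data.intro submonoid.intro)
    show "cring S" by (rule cring_axioms)
    show "homogeneous S - P \<subseteq> carrier S" by (auto intro: homogeneous_carrier)
    show "x \<otimes> y \<in> homogeneous S - P" if "x \<in> homogeneous S - P" "y \<in> homogeneous S - P" for x y
      using that I_prime[of x y] by (auto intro: homogeneous_mult homogeneous_carrier)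
    show "\<one> \<in> homogeneous S - P"
      using one_notin_Proj[OF assms] by (auto intro: homogeneousI hcomp_one)
  qed
qed

lemma homogeneous_idealI:
  assumes "G \<subseteq> homogeneous S" "J = genideal S G"
  shows "homogeneous_ideal S J"
proof -
  have G: "G \<subseteq> carrier S" using assms(1) homogeneous_carrier by blast
  then have J: "ideal J S" unfolding assms(2) by (rule genideal_ideal)
  have "G \<subseteq> J" unfolding assms(2) by (rule genideal_self[OF G])
  have JS: "J \<subseteq> carrier S" using J by (simp add: additive_subgroup.a_subset ideal_def)
  have "J \<subseteq> genideal S (J \<inter> homogeneous S)"
  proof -
    have "genideal S G \<subseteq> genideal S (J \<inter> homogeneous S)"
      using assms(1) \<open>G \<subseteq> J\<close> JS genideal_self[of "J \<inter> homogeneous S"]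
      by (intro genideal_minimal genideal_ideal) auto
    then show ?thesis by (simp add: assms(2))
  qed
  moreover have "genideal S (J \<inter> homogeneous S) \<subseteq> J"
    by (rule genideal_minimal[OF J]) auto
  ultimately show ?thesis using J by (simp add: homogeneous_ideal_def)
qed

lemma zariski_open_Proj: "zariski_open S (Proj S)"
proof -
  have "homogeneous_ideal S (genideal S {\<one>})"
    by (rule homogeneous_idealI[OF _ refl]) (auto intro: homogeneousI hcomp_one)
  moreover have "Proj S = {P \<in> Proj S. \<not> genideal S {\<one>} \<subseteq> P}"
    using one_notin_Proj genideal_self'[OF one_closed] by blast
  ultimately show ?thesis unfolding zariski_open_def by blast
qed

lemma not_subset_homogeneous:
  assumes "homogeneous_ideal S J" "ideal P S"
  shows "\<not> J \<subseteq> P \<longleftrightarrow> (\<exists>a\<in>J \<inter> homogeneous S. a \<notin> P)"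
  using assms genideal_minimal[OF assms(2), of "J \<inter> homogeneous S"]
  unfolding homogeneous_ideal_def by blast

text \<open>
  The intersection of the loci where \<open>J\<close> and \<open>K\<close> do not vanish is the locus where their products do
  not vanish. It suffices to take products of homogeneous elements, which keeps the ideal homogeneous.
\<close>

lemma zariski_open_Int:
  assumes "zariski_open S U" "zariski_open S V"
  shows "zariski_open S (U \<inter> V)"
proof -
  obtain J K where J: "homogeneous_ideal S J" "U = {P \<in> Proj S. \<not> J \<subseteq> P}"
    and K: "homogeneous_ideal S K" "V = {P \<in> Proj S. \<not> K \<subseteq> P}"
    using assms unfolding zariski_open_def by blast
  define G where "G = {a \<otimes> b | a b. a \<in> J \<inter> homogeneous S \<and> b \<in> K \<inter> homogeneous S}"
  have G: "G \<subseteq> homogeneous S" unfolding G_def using homogeneous_mult by blast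
  then have G': "G \<subseteq> carrier S" using homogeneous_carrier by blast
  have "\<not> genideal S G \<subseteq> P \<longleftrightarrow> \<not> J \<subseteq> P \<and> \<not> K \<subseteq> P" if "P \<in> Proj S" for P
  proof -
    interpret primeideal P S using that by (rule Proj_primeideal)
    have prod: "a \<otimes> b \<notin> P \<longleftrightarrow> a \<notin> P \<and> b \<notin> P"
      if "a \<in> homogeneous S" "b \<in> homogeneous S" for a b
      using I_prime[of a b] I_l_closed[of b a] I_r_closed[of a b]
        homogeneous_carrier[OF that(1)] homogeneous_carrier[OF that(2)] by blast
    have "\<not> genideal S G \<subseteq> P \<longleftrightarrow> (\<exists>c\<in>G. c \<notin> P)"
      using genideal_minimal[OF is_ideal, of G] genideal_self[OF G'] by blast
    also have "\<dots> \<longleftrightarrow> (\<exists>a\<in>J \<inter> homogeneous S. \<exists>b\<in>K \<inter> homogeneous S. a \<otimes> b \<notin> P)"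
      unfolding G_def by blast
    also have "\<dots> \<longleftrightarrow> (\<exists>a\<in>J \<inter> homogeneous S. a \<notin> P) \<and> (\<exists>b\<in>K \<inter> homogeneous S. b \<notin> P)"
      using prod by (auto simp: Bex_def)
    finally show ?thesis
      using not_subset_homogeneous[OF J(1) is_ideal] not_subset_homogeneous[OF K(1) is_ideal]
      by blast
  qed
  then have "U \<inter> V = {P \<in> Proj S. \<not> genideal S G \<subseteq> P}"
    using J K by blast
  then show ?thesis
    unfolding zariski_open_def using homogeneous_idealI[OF G refl] by blast
qed

lemma twist_sections_extensional: "f \<in> twist_sections S n U \<Longrightarrow> f \<in> extensional U"
  by (simp only: twist_sections_def mem_Collect_eq PiE_iff)

lemma twist_sections_local:
  assumes "f \<in> twist_sections S n (Proj S)" "P \<in> Proj S"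
  obtains V a d s where "zariski_open S V" "P \<in> V" "V \<subseteq> Proj S" "a \<in> hcomp S (d + n)"
    "s \<in> hcomp S d" "\<And>Q. Q \<in> V \<Longrightarrow> s \<notin> Q \<and> f Q = germ Q a s"
proof -
  note local_frac = conjunct2[OF assms(1)[unfolded twist_sections_def mem_Collect_eq]]
  from bspec[OF local_frac assms(2)] show ?thesis
    using that by metis
qed

lemma twist_sectionsI:
  assumes "f \<in> extensional (Proj S)"
    and local_frac: "\<And>P. P \<in> Proj S \<Longrightarrow> \<exists>V a s d. zariski_open S V \<and> P \<in> V \<and> V \<subseteq> Proj S \<and>
      a \<in> hcomp S (d + n) \<and> s \<in> hcomp S d \<and> (\<forall>Q\<in>V. s \<notin> Q \<and> f Q = germ Q a s)"
  shows "f \<in> twist_sections S n (Proj S)"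
proof -
  have "f P \<in> twist_stalk S n P" if P: "P \<in> Proj S" for P
  proof -
    obtain V a s d where "P \<in> V" "a \<in> hcomp S (d + n)" "s \<in> hcomp S d"
        "\<forall>Q\<in>V. s \<notin> Q \<and> f Q = germ Q a s"
      using local_frac[OF P] by metis
    then show ?thesis unfolding twist_stalk_def by blast
  qed
  then show ?thesis
    unfolding twist_sections_def mem_Collect_eq PiE_iff using assms by (intro conjI ballI) simp_all
qed

lemma twist_sections_carrier:
  assumes "f \<in> twist_sections S n (Proj S)" "P \<in> Proj S"
  shows "f P \<in> carrier (R\<^sub>P P)"
proof -
  interpret localization_data S "homogeneous S - P" using assms(2) by (rule Proj_localization_data)
  obtain V a s d where "P \<in> V" "a \<in> hcomp S (d + n)" "s \<in> hcomp S d"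
    "\<And>Q. Q \<in> V \<Longrightarrow> s \<notin> Q \<and> f Q = germ Q a s"
    using twist_sections_local[OF assms] by metis
  then show ?thesis
    using fraction_in_localization[of a s] hcomp_carrier[of a "d + n"] homogeneousI[of s d] by simp
qed

text \<open>
  Around every point two sections are single fractions \<open>a / s\<close> and \<open>b / t\<close> on a common neighbourhood.
  An operation on germs that is given by a formula for the numerator over the denominator \<open>s t\<close>
  therefore produces a section again. Addition and multiplication are instances, with different degrees.
\<close>

lemma twist_sections_pointwise:
  assumes f: "f \<in> twist_sections S m (Proj S)" and g: "g \<in> twist_sections S n (Proj S)"
    and deg: "\<And>a s d b t e. \<lbrakk>a \<in> hcomp S (d + m); s \<in> hcomp S d; b \<in> hcomp S (e + n); t \<in> hcomp S e\<rbrakk>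
      \<Longrightarrow> num a s b t \<in> hcomp S (d + e + l)"
    and opr: "\<And>P a s b t. \<lbrakk>P \<in> Proj S; a \<in> carrier S; s \<in> homogeneous S - P; b \<in> carrier S;
      t \<in> homogeneous S - P\<rbrakk> \<Longrightarrow> opr P (germ P a s) (germ P b t) = germ P (num a s b t) (s \<otimes> t)"
  shows "(\<lambda>P\<in>Proj S. opr P (f P) (g P)) \<in> twist_sections S l (Proj S)"
proof (rule twist_sectionsI)
  fix P assume P: "P \<in> Proj S"
  obtain V a s d where V: "zariski_open S V" "P \<in> V" "V \<subseteq> Proj S" "a \<in> hcomp S (d + m)"
    "s \<in> hcomp S d" "\<And>Q. Q \<in> V \<Longrightarrow> s \<notin> Q \<and> f Q = germ Q a s"
    using twist_sections_local[OF f P] by metis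
  obtain W b t e where W: "zariski_open S W" "P \<in> W" "W \<subseteq> Proj S" "b \<in> hcomp S (e + n)"
    "t \<in> hcomp S e" "\<And>Q. Q \<in> W \<Longrightarrow> t \<notin> Q \<and> g Q = germ Q b t"
    using twist_sections_local[OF g P] by metis
  have "s \<otimes> t \<notin> Q \<and> (\<lambda>P\<in>Proj S. opr P (f P) (g P)) Q = germ Q (num a s b t) (s \<otimes> t)"
    if "Q \<in> V \<inter> W" for Q
  proof -
    have Q: "Q \<in> Proj S" using that V(3) by blast
    interpret localization_data S "homogeneous S - Q" using Q by (rule Proj_localization_data)
    have st: "s \<in> homogeneous S - Q" "t \<in> homogeneous S - Q"
      using that V(5,6) W(5,6) by (auto intro: homogeneousI)
    then have "s \<otimes> t \<in> homogeneous S - Q" by (rule m_closed)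
    moreover have "opr Q (f Q) (g Q) = germ Q (num a s b t) (s \<otimes> t)"
      using that V(6) W(6) opr[OF Q hcomp_carrier[OF V(4)] st(1) hcomp_carrier[OF W(4)] st(2)]
      by simp
    ultimately show ?thesis using Q by simp
  qed
  moreover have "num a s b t \<in> hcomp S (d + e + l)" "s \<otimes> t \<in> hcomp S (d + e)"
    using deg[OF V(4,5) W(4,5)] hcomp_mult[OF V(5) W(5)] by auto
  ultimately show "\<exists>V a s d. zariski_open S V \<and> P \<in> V \<and> V \<subseteq> Proj S \<and> a \<in> hcomp S (d + l) \<and>
      s \<in> hcomp S d \<and> (\<forall>Q\<in>V. s \<notin> Q \<and> (\<lambda>P\<in>Proj S. opr P (f P) (g P)) Q = germ Q a s)"
    using zariski_open_Int[OF V(1) W(1)] V(2,3) W(2)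
    by (intro exI[of _ "V \<inter> W"] exI[of _ "num a s b t"] exI[of _ "s \<otimes> t"] exI[of _ "d + e"]) auto
qed auto

lemma twist_sections_add:
  assumes "f \<in> twist_sections S n (Proj S)" "g \<in> twist_sections S n (Proj S)"
  shows "(\<lambda>P\<in>Proj S. f P \<oplus>\<^bsub>R\<^sub>P P\<^esub> g P) \<in> twist_sections S n (Proj S)"
proof (rule twist_sections_pointwise[OF assms, where num = "\<lambda>a s b t. a \<otimes> t \<oplus> b \<otimes> s"])
  fix a s d b t e
  assume "a \<in> hcomp S (d + n)" "s \<in> hcomp S d" "b \<in> hcomp S (e + n)" "t \<in> hcomp S e"
  then show "a \<otimes> t \<oplus> b \<otimes> s \<in> hcomp S (d + e + n)"
    using hcomp_mult[of a "d + n" t e] hcomp_mult[of b "e + n" s d]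
    by (intro hcomp_add) (simp_all add: ac_simps)
qed (rule localization_data.add_fraction[OF Proj_localization_data])

lemma twist_sections_mult:
  assumes "f \<in> twist_sections S m (Proj S)" "g \<in> twist_sections S n (Proj S)"
  shows "(\<lambda>P\<in>Proj S. f P \<otimes>\<^bsub>R\<^sub>P P\<^esub> g P) \<in> twist_sections S (m + n) (Proj S)"
proof (rule twist_sections_pointwise[OF assms, where num = "\<lambda>a s b t. a \<otimes> b"])
  fix a s d b t e
  assume "a \<in> hcomp S (d + m)" "s \<in> hcomp S d" "b \<in> hcomp S (e + n)" "t \<in> hcomp S e"
  then show "a \<otimes> b \<in> hcomp S (d + e + (m + n))"
    using hcomp_mult[of a "d + m" b "e + n"] by (simp add: ac_simps)
qed (rule localization_data.mult_fraction[OF Proj_localization_data])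

definition global_section :: "'a \<Rightarrow> 'a set \<Rightarrow> ('a \<times> 'a) set" where
  "global_section a = (\<lambda>P\<in>Proj S. germ P a \<one>)"

lemma global_section_twist: "a \<in> hcomp S n \<Longrightarrow> global_section a \<in> twist_sections S n (Proj S)"
  unfolding global_section_def
  using zariski_open_Proj hcomp_one one_notin_Proj
  by (intro twist_sectionsI exI[of _ "Proj S"] exI[of _ a] exI[of _ \<one>] exI[of _ 0]) auto

lemma germ_ring_hom: "P \<in> Proj S \<Longrightarrow> (\<lambda>a. germ P a \<one>) \<in> ring_hom S (R\<^sub>P P)"
  by (rule localization_data.fraction_one_ring_hom[OF Proj_localization_data])

lemma cring_stalk: "P \<in> Proj S \<Longrightarrow> cring (R\<^sub>P P)"
  by (rule localization_data.cring_localization[OF Proj_localization_data])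

lemma zero_section_global: "zero_section S = global_section \<zero>"
  using localization_data.zero_localization[OF Proj_localization_data]
  by (auto simp: zero_section_def global_section_def intro!: restrict_ext)

lemma zero_section_twist: "zero_section S \<in> twist_sections S n (Proj S)"
  unfolding zero_section_global by (intro global_section_twist hcomp_zero)

lemma global_section_add:
  assumes "a \<in> carrier S" "b \<in> carrier S"
  shows "(\<lambda>P\<in>Proj S. global_section a P \<oplus>\<^bsub>R\<^sub>P P\<^esub> global_section b P) = global_section (a \<oplus> b)"
  using assms by (auto simp: global_section_def ring_hom_add[OF germ_ring_hom] intro!: restrict_ext)

text \<open>
  Negation is multiplication by the section \<open>-1\<close> of degree \<open>0\<close>.
\<close>

lemma twist_sections_neg:
  assumes "f \<in> twist_sections S n (Proj S)"
  shows "(\<lambda>P\<in>Proj S. \<ominus>\<^bsub>R\<^sub>P P\<^esub> f P) \<in> twist_sections S n (Proj S)"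
proof -
  have "\<ominus>\<^bsub>R\<^sub>P P\<^esub> f P = global_section (\<ominus> \<one>) P \<otimes>\<^bsub>R\<^sub>P P\<^esub> f P" if P: "P \<in> Proj S" for P
  proof -
    interpret loc: cring "R\<^sub>P P" by (rule cring_stalk[OF P])
    interpret h: ring_hom_cring S "R\<^sub>P P" "\<lambda>a. germ P a \<one>"
      by (intro ring_hom_cring.intro ring_hom_cring_axioms.intro cring_axioms loc.cring_axioms germ_ring_hom P)
    show ?thesis
      using twist_sections_carrier[OF assms P] P
      by (simp add: global_section_def loc.l_minus)
  qed
  then have "(\<lambda>P\<in>Proj S. \<ominus>\<^bsub>R\<^sub>P P\<^esub> f P)
      = (\<lambda>P\<in>Proj S. global_section (\<ominus> \<one>) P \<otimes>\<^bsub>R\<^sub>P P\<^esub> f P)"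
    by (auto intro: restrict_ext)
  then show ?thesis
    using twist_sections_mult[OF global_section_twist[OF hcomp_neg[OF hcomp_one]] assms] by simp
qed

lemma twist_sections_finsum:
  assumes "finite I" "\<And>i. i \<in> I \<Longrightarrow> f i \<in> twist_sections S n (Proj S)"
  shows "(\<lambda>P\<in>Proj S. finsum (R\<^sub>P P) (\<lambda>i. f i P) I) \<in> twist_sections S n (Proj S)"
  using assms
proof (induction I)
  case empty
  have "(\<lambda>P\<in>Proj S. finsum (R\<^sub>P P) (\<lambda>i. f i P) {}) = zero_section S"
    unfolding zero_section_def
    using abelian_monoid.finsum_empty[OF abelian_group.axioms(1)[OF ring.is_abelian_group[OF cring.axioms(1)[OF cring_stalk]]]]
    by (intro restrict_ext) blast
  then show ?case by (simp add: zero_section_twist)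
next
  case (insert i I)
  have "finsum (R\<^sub>P P) (\<lambda>i. f i P) (insert i I)
      = f i P \<oplus>\<^bsub>R\<^sub>P P\<^esub> (\<lambda>P\<in>Proj S. finsum (R\<^sub>P P) (\<lambda>i. f i P) I) P" if P: "P \<in> Proj S" for P
  proof -
    interpret loc: cring "R\<^sub>P P" by (rule cring_stalk[OF P])
    have "f j P \<in> carrier (R\<^sub>P P)" if "j \<in> insert i I" for j
      by (rule twist_sections_carrier[OF insert.prems[OF that] P])
    then show ?thesis
      using insert.hyps P by (simp add: Pi_def)
  qed
  then have eq: "(\<lambda>P\<in>Proj S. finsum (R\<^sub>P P) (\<lambda>i. f i P) (insert i I))
      = (\<lambda>P\<in>Proj S. f i P \<oplus>\<^bsub>R\<^sub>P P\<^esub> (\<lambda>P\<in>Proj S. finsum (R\<^sub>P P) (\<lambda>i. f i P) I) P)"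
    by (intro restrict_ext)
  show ?case
    unfolding eq by (intro twist_sections_add insert.prems insert.IH) auto
qed

end

section \<open>The algebra of sections\<close>

text \<open>
  At a point \<open>P\<close>, an element \<open>y\<close> of the algebra of sections yields the sequence of germs \<open>y n P\<close>. Such
  a sequence is a univariate polynomial over the ring of germs \<open>R\<^sub>P P\<close>, and the multiplication of the
  algebra is the multiplication of polynomials. Since sections are determined by their germs, the
  algebra embeds into a product of polynomial rings, which gives the ring axioms.
\<close>

lemma cring_UP: "cring R \<Longrightarrow> cring (UP R)"
  by (rule UP_cring.UP_cring[OF UP_cring.intro])

context graded_comm_algebra
begin

definition in_degree :: "nat \<Rightarrow> ('a set \<Rightarrow> ('a \<times> 'a) set) \<Rightarrow> nat \<Rightarrow> 'a set \<Rightarrow> ('a \<times> 'a) set" where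
  "in_degree n f = (\<lambda>m. if m = n then f else zero_section S)"

lemma in_degree_simps [simp]: "in_degree n f n = f" "m \<noteq> n \<Longrightarrow> in_degree n f m = zero_section S"
  by (auto simp: in_degree_def)

context
  fixes d :: nat
begin

abbreviation A where "A \<equiv> section_algebra S d"

lemma mem_section_algebra:
  "y \<in> carrier A \<longleftrightarrow>
    (\<forall>n. y n \<in> twist_sections S (d * n) (Proj S)) \<and> finite {n. y n \<noteq> zero_section S}"
  by (simp add: section_algebra_def Let_def)

lemma section_algebra_add:
  "y \<oplus>\<^bsub>A\<^esub> z = (\<lambda>n. \<lambda>P\<in>Proj S. y n P \<oplus>\<^bsub>R\<^sub>P P\<^esub> z n P)"
  by (simp add: section_algebra_def Let_def)

lemma section_algebra_mult:
  "y \<otimes>\<^bsub>A\<^esub> z = (\<lambda>n. \<lambda>P\<in>Proj S. finsum (R\<^sub>P P) (\<lambda>i. y i P \<otimes>\<^bsub>R\<^sub>P P\<^esub> z (n - i) P) {..n})"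
  by (simp add: section_algebra_def Let_def)

lemma section_algebra_zero: "\<zero>\<^bsub>A\<^esub> = (\<lambda>n. zero_section S)"
  by (simp add: section_algebra_def Let_def)

lemma section_algebra_one: "\<one>\<^bsub>A\<^esub> = in_degree 0 (global_section \<one>)"
  by (auto simp: section_algebra_def Let_def in_degree_def global_section_def)

lemma section_algebra_scal: "scal A c = in_degree 0 (global_section (scal S c))"
  by (auto simp: section_algebra_def Let_def in_degree_def global_section_def)

lemma section_algebra_hcomp:
  "y \<in> hcomp A n \<longleftrightarrow> y \<in> carrier A \<and> (\<forall>m. m \<noteq> n \<longrightarrow> y m = zero_section S)"
  by (simp add: section_algebra_def Let_def)

lemma section_component: "y \<in> carrier A \<Longrightarrow> y n \<in> twist_sections S (d * n) (Proj S)"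
  by (simp add: mem_section_algebra)

lemma in_degree_hcomp:
  assumes "f \<in> twist_sections S (d * n) (Proj S)"
  shows "in_degree n f \<in> hcomp A n"
proof -
  have "{m. in_degree n f m \<noteq> zero_section S} \<subseteq> {n}"
    by (auto simp: in_degree_def)
  then have "finite {m. in_degree n f m \<noteq> zero_section S}"
    by (rule finite_subset) simp
  then show ?thesis
    using assms zero_section_twist
    by (simp add: section_algebra_hcomp mem_section_algebra in_degree_def)
qed

lemma hcomp_in_degree: "y \<in> hcomp A n \<Longrightarrow> y = in_degree n (y n)"
  by (auto simp: section_algebra_hcomp in_degree_def)

lemma zero_section_apply: "P \<in> Proj S \<Longrightarrow> zero_section S P = \<zero>\<^bsub>R\<^sub>P P\<^esub>"
  by (simp add: zero_section_def)

text \<open>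
  Only finitely many components of \<open>y\<close> differ from zero, hence their germs at \<open>P\<close> are bounded.
\<close>

lemma germs_in_UP:
  assumes "y \<in> carrier A" "P \<in> Proj S"
  shows "(\<lambda>n. y n P) \<in> carrier (UP (R\<^sub>P P))"
proof -
  obtain N where N: "\<And>n. y n \<noteq> zero_section S \<Longrightarrow> n \<le> N"
    using assms(1) finite_nat_set_iff_bounded_le[of "{n. y n \<noteq> zero_section S}"]
    by (auto simp: mem_section_algebra)
  have "y n P = \<zero>\<^bsub>R\<^sub>P P\<^esub>" if "N < n" for n
    using N[of n] that assms(2) zero_section_apply by fastforce
  then have "bound \<zero>\<^bsub>R\<^sub>P P\<^esub> N (\<lambda>n. y n P)"
    by (auto intro: bound.intro)
  then show ?thesis
    using twist_sections_carrier[OF section_component[OF assms(1)] assms(2)]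
    by (auto simp: UP_def)
qed

lemma section_eqI:
  assumes "y \<in> carrier A" "z \<in> carrier A"
    and "\<And>P. P \<in> Proj S \<Longrightarrow> (\<lambda>n. y n P) = (\<lambda>n. z n P)"
  shows "y = z"
proof (intro ext)
  fix n
  have "y n \<in> extensional (Proj S)" "z n \<in> extensional (Proj S)"
    using assms(1,2) section_component twist_sections_extensional by blast+
  moreover have "y n P = z n P" if "P \<in> Proj S" for P
    using fun_cong[OF assms(3)[OF that]] .
  ultimately have "y n = z n"
    by (rule extensionalityI)
  then show "y n P = z n P" for P by simp
qed

lemma germs_add:
  assumes "y \<in> carrier A" "z \<in> carrier A" "P \<in> Proj S"
  shows "(\<lambda>n. (y \<oplus>\<^bsub>A\<^esub> z) n P) = (\<lambda>n. y n P) \<oplus>\<^bsub>UP (R\<^sub>P P)\<^esub> (\<lambda>n. z n P)"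
  using germs_in_UP[OF assms(1,3)] germs_in_UP[OF assms(2,3)] assms(3)
  by (simp add: section_algebra_add UP_def)

lemma germs_mult:
  assumes "y \<in> carrier A" "z \<in> carrier A" "P \<in> Proj S"
  shows "(\<lambda>n. (y \<otimes>\<^bsub>A\<^esub> z) n P) = (\<lambda>n. y n P) \<otimes>\<^bsub>UP (R\<^sub>P P)\<^esub> (\<lambda>n. z n P)"
  using germs_in_UP[OF assms(1,3)] germs_in_UP[OF assms(2,3)] assms(3)
  by (simp add: section_algebra_mult UP_def)

lemma germs_zero: "P \<in> Proj S \<Longrightarrow> (\<lambda>n. \<zero>\<^bsub>A\<^esub> n P) = \<zero>\<^bsub>UP (R\<^sub>P P)\<^esub>"
  by (simp add: section_algebra_zero UP_def zero_section_apply)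

lemma germs_one: "P \<in> Proj S \<Longrightarrow> (\<lambda>n. \<one>\<^bsub>A\<^esub> n P) = \<one>\<^bsub>UP (R\<^sub>P P)\<^esub>"
  using ring_hom_one[OF germ_ring_hom]
  by (intro ext)
    (simp add: section_algebra_one UP_def zero_section_apply in_degree_def global_section_def)

lemma zero_sectionI:
  assumes "f \<in> extensional (Proj S)" "\<And>P. P \<in> Proj S \<Longrightarrow> f P = \<zero>\<^bsub>R\<^sub>P P\<^esub>"
  shows "f = zero_section S"
  by (rule extensionalityI[OF assms(1)]) (auto simp: zero_section_def assms(2))

lemma section_algebra_add_closed:
  assumes "y \<in> carrier A" "z \<in> carrier A"
  shows "y \<oplus>\<^bsub>A\<^esub> z \<in> carrier A"
proof -
  have "(y \<oplus>\<^bsub>A\<^esub> z) n = zero_section S" if "y n = zero_section S" "z n = zero_section S" for n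
  proof (rule zero_sectionI)
    fix P assume P: "P \<in> Proj S"
    interpret loc: cring "R\<^sub>P P" by (rule cring_stalk[OF P])
    show "(y \<oplus>\<^bsub>A\<^esub> z) n P = \<zero>\<^bsub>R\<^sub>P P\<^esub>"
      using that P by (simp add: section_algebra_add zero_section_apply)
  qed (simp add: section_algebra_add)
  then have "{n. (y \<oplus>\<^bsub>A\<^esub> z) n \<noteq> zero_section S}
      \<subseteq> {n. y n \<noteq> zero_section S} \<union> {n. z n \<noteq> zero_section S}"
    by blast
  then have "finite {n. (y \<oplus>\<^bsub>A\<^esub> z) n \<noteq> zero_section S}"
    using assms by (elim finite_subset) (simp add: mem_section_algebra)
  moreover have "(y \<oplus>\<^bsub>A\<^esub> z) n \<in> twist_sections S (d * n) (Proj S)" for n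
    unfolding section_algebra_add by (intro twist_sections_add section_component assms)
  ultimately show ?thesis by (simp add: mem_section_algebra)
qed

lemma section_algebra_mult_closed:
  assumes "y \<in> carrier A" "z \<in> carrier A"
  shows "y \<otimes>\<^bsub>A\<^esub> z \<in> carrier A"
proof -
  \<comment> \<open>A component of degree \<open>n\<close> of the product can only come from nonzero components
      of degrees \<open>i\<close> and \<open>n - i\<close>; this bounds the support of the product by a sumset.\<close>
  have "(y \<otimes>\<^bsub>A\<^esub> z) n = zero_section S"
    if "\<forall>i\<le>n. y i = zero_section S \<or> z (n - i) = zero_section S" for n
  proof (rule zero_sectionI)
    fix P assume P: "P \<in> Proj S"
    interpret loc: cring "R\<^sub>P P" by (rule cring_stalk[OF P])
    have "y i P \<otimes>\<^bsub>R\<^sub>P P\<^esub> z (n - i) P = \<zero>\<^bsub>R\<^sub>P P\<^esub>" if "i \<in> {..n}" for i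
      using \<open>\<forall>i\<le>n. _ i\<close>[rule_format, of i] that zero_section_apply[OF P]
        twist_sections_carrier[OF section_component[OF assms(1)] P]
        twist_sections_carrier[OF section_component[OF assms(2)] P] by auto
    then have "finsum (R\<^sub>P P) (\<lambda>i. y i P \<otimes>\<^bsub>R\<^sub>P P\<^esub> z (n - i) P) {..n} = \<zero>\<^bsub>R\<^sub>P P\<^esub>"
      by (rule loc.add.finprod_one_eqI)
    then show "(y \<otimes>\<^bsub>A\<^esub> z) n P = \<zero>\<^bsub>R\<^sub>P P\<^esub>"
      using P by (simp add: section_algebra_mult)
  qed (simp add: section_algebra_mult)
  note mult_zero = this
  have "n \<in> (\<lambda>(i, j). i + j) ` ({n. y n \<noteq> zero_section S} \<times> {n. z n \<noteq> zero_section S})"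
    if nz: "(y \<otimes>\<^bsub>A\<^esub> z) n \<noteq> zero_section S" for n
  proof -
    obtain i where "i \<le> n" "y i \<noteq> zero_section S" "z (n - i) \<noteq> zero_section S"
      using mult_zero[of n] nz by blast
    then show ?thesis by (intro image_eqI[of _ _ "(i, n - i)"]) simp_all
  qed
  then have "{n. (y \<otimes>\<^bsub>A\<^esub> z) n \<noteq> zero_section S} \<subseteq>
      (\<lambda>(i, j). i + j) ` ({n. y n \<noteq> zero_section S} \<times> {n. z n \<noteq> zero_section S})"
    by blast
  then have "finite {n. (y \<otimes>\<^bsub>A\<^esub> z) n \<noteq> zero_section S}"
    using assms by (elim finite_subset) (simp add: mem_section_algebra)
  moreover have "(y \<otimes>\<^bsub>A\<^esub> z) n \<in> twist_sections S (d * n) (Proj S)" for n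
  proof -
    have f: "(\<lambda>P\<in>Proj S. y i P \<otimes>\<^bsub>R\<^sub>P P\<^esub> z (n - i) P) \<in> twist_sections S (d * n) (Proj S)"
      if "i \<in> {..n}" for i
    proof -
      have "d * n = d * i + d * (n - i)"
        using that by (simp flip: distrib_left)
      then show ?thesis
        using twist_sections_mult[OF section_component[OF assms(1), of i]
            section_component[OF assms(2), of "n - i"]] by simp
    qed
    have eq: "(y \<otimes>\<^bsub>A\<^esub> z) n = (\<lambda>P\<in>Proj S. finsum (R\<^sub>P P)
        (\<lambda>i. (\<lambda>P\<in>Proj S. y i P \<otimes>\<^bsub>R\<^sub>P P\<^esub> z (n - i) P) P) {..n})"
      unfolding section_algebra_mult by (rule restrict_ext) simp
    show ?thesis
      unfolding eq by (rule twist_sections_finsum[OF finite_atMost f])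
  qed
  ultimately show ?thesis by (simp add: mem_section_algebra)
qed

lemma section_algebra_one_closed: "\<one>\<^bsub>A\<^esub> \<in> carrier A"
  using in_degree_hcomp[of "global_section \<one>" 0] global_section_twist[OF hcomp_one]
  by (simp add: section_algebra_one section_algebra_hcomp)

lemma section_algebra_zero_closed: "\<zero>\<^bsub>A\<^esub> \<in> carrier A"
  by (simp add: section_algebra_zero mem_section_algebra zero_section_twist)

lemma section_algebra_neg:
  assumes "y \<in> carrier A"
  defines "y' \<equiv> \<lambda>n. \<lambda>P\<in>Proj S. \<ominus>\<^bsub>R\<^sub>P P\<^esub> y n P"
  shows "y' \<in> carrier A" "y' \<oplus>\<^bsub>A\<^esub> y = \<zero>\<^bsub>A\<^esub>"
proof -
  have "y' n = zero_section S" if "y n = zero_section S" for n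
  proof (rule zero_sectionI)
    fix P assume P: "P \<in> Proj S"
    interpret loc: cring "R\<^sub>P P" by (rule cring_stalk[OF P])
    show "y' n P = \<zero>\<^bsub>R\<^sub>P P\<^esub>"
      using that P by (simp add: y'_def zero_section_apply)
  qed (simp add: y'_def)
  then have "{n. y' n \<noteq> zero_section S} \<subseteq> {n. y n \<noteq> zero_section S}"
    by blast
  then have "finite {n. y' n \<noteq> zero_section S}"
    using assms by (elim finite_subset) (simp add: mem_section_algebra)
  moreover have "y' n \<in> twist_sections S (d * n) (Proj S)" for n
    unfolding y'_def by (intro twist_sections_neg section_component assms)
  ultimately show "y' \<in> carrier A" by (simp add: mem_section_algebra)
  have "(y' \<oplus>\<^bsub>A\<^esub> y) n = zero_section S" for n
  proof (rule zero_sectionI)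
    fix P assume P: "P \<in> Proj S"
    interpret loc: cring "R\<^sub>P P" by (rule cring_stalk[OF P])
    show "(y' \<oplus>\<^bsub>A\<^esub> y) n P = \<zero>\<^bsub>R\<^sub>P P\<^esub>"
      using P twist_sections_carrier[OF section_component[OF assms(1)] P]
      by (simp add: y'_def section_algebra_add loc.l_neg)
  qed (simp add: section_algebra_add)
  then show "y' \<oplus>\<^bsub>A\<^esub> y = \<zero>\<^bsub>A\<^esub>"
    by (auto simp: section_algebra_zero)
qed

text \<open>
  Every identity is checked on germs, where it is an identity in a polynomial ring.
\<close>

lemma cring_section_algebra: "cring A"
proof -
  note closed = section_algebra_add_closed section_algebra_mult_closed
    section_algebra_one_closed section_algebra_zero_closed
  note germs = germs_add germs_mult germs_zero germs_one germs_in_UP closed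
  have up: "cring (UP (R\<^sub>P P))" if "P \<in> Proj S" for P
    by (rule cring_UP[OF cring_stalk[OF that]])
  note cr = cring.axioms(1)[OF up]
  show ?thesis
  proof (intro cringI abelian_groupI comm_monoidI)
    fix x y z
    assume xyz: "x \<in> carrier A" "y \<in> carrier A" "z \<in> carrier A"
    show "x \<oplus>\<^bsub>A\<^esub> y \<oplus>\<^bsub>A\<^esub> z = x \<oplus>\<^bsub>A\<^esub> (y \<oplus>\<^bsub>A\<^esub> z)"
      using xyz by (intro section_eqI closed) (simp_all add: germs ring.ring_simprules[OF cr])
    show "x \<otimes>\<^bsub>A\<^esub> y \<otimes>\<^bsub>A\<^esub> z = x \<otimes>\<^bsub>A\<^esub> (y \<otimes>\<^bsub>A\<^esub> z)"
      using xyz by (intro section_eqI closed) (simp_all add: germs cring.cring_simprules(11)[OF up])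
    show "(x \<oplus>\<^bsub>A\<^esub> y) \<otimes>\<^bsub>A\<^esub> z = x \<otimes>\<^bsub>A\<^esub> z \<oplus>\<^bsub>A\<^esub> y \<otimes>\<^bsub>A\<^esub> z"
      using xyz by (intro section_eqI closed) (simp_all add: germs ring.ring_simprules[OF cr])
  next
    fix x y
    assume xy: "x \<in> carrier A" "y \<in> carrier A"
    show "x \<oplus>\<^bsub>A\<^esub> y = y \<oplus>\<^bsub>A\<^esub> x"
      using xy by (intro section_eqI closed) (simp_all add: germs ring.ring_simprules(10)[OF cr])
    show "x \<otimes>\<^bsub>A\<^esub> y = y \<otimes>\<^bsub>A\<^esub> x"
      using xy by (intro section_eqI closed) (simp_all add: germs cring.cring_simprules(14)[OF up])
  next
    fix x
    assume x: "x \<in> carrier A"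
    show "\<zero>\<^bsub>A\<^esub> \<oplus>\<^bsub>A\<^esub> x = x"
      using x by (intro section_eqI closed) (simp_all add: germs ring.ring_simprules[OF cr])
    show "\<one>\<^bsub>A\<^esub> \<otimes>\<^bsub>A\<^esub> x = x"
      using x by (intro section_eqI closed) (simp_all add: germs ring.ring_simprules[OF cr])
    show "\<exists>y\<in>carrier A. y \<oplus>\<^bsub>A\<^esub> x = \<zero>\<^bsub>A\<^esub>"
      using section_algebra_neg[OF x] by blast
  qed (auto intro: closed)
qed

section \<open>Graded linear series from graded subalgebras of the coordinate ring\<close>

definition homogeneous_section :: "nat \<Rightarrow> 'a \<Rightarrow> nat \<Rightarrow> 'a set \<Rightarrow> ('a \<times> 'a) set" where
  "homogeneous_section n a = in_degree n (global_section a)"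

lemma homogeneous_section_hcomp:
  "a \<in> hcomp S (d * n) \<Longrightarrow> homogeneous_section n a \<in> hcomp A n"
  unfolding homogeneous_section_def by (intro in_degree_hcomp global_section_twist)

lemma homogeneous_section_carrier:
  "a \<in> hcomp S (d * n) \<Longrightarrow> homogeneous_section n a \<in> carrier A"
  using homogeneous_section_hcomp[of a n] by (simp add: section_algebra_hcomp)

lemma homogeneous_section_zero: "homogeneous_section n \<zero> = \<zero>\<^bsub>A\<^esub>"
  by (auto simp: homogeneous_section_def in_degree_def section_algebra_zero zero_section_global)

lemma homogeneous_section_eq_iff:
  "homogeneous_section n a = homogeneous_section n b \<longleftrightarrow> global_section a = global_section b"
  unfolding homogeneous_section_def using in_degree_simps(1) by metis

lemma scal_eq_homogeneous_section: "scal A c = homogeneous_section 0 (scal S c)"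
  by (simp add: section_algebra_scal homogeneous_section_def)

lemma germs_homogeneous_section:
  assumes "a \<in> carrier S" "P \<in> Proj S"
  shows "(\<lambda>k. homogeneous_section n a k P) = up_ring.monom (UP (R\<^sub>P P)) (germ P a \<one>) n"
  using assms ring_hom_closed[OF germ_ring_hom[OF assms(2)] assms(1)]
  by (intro ext) (simp add: UP_def homogeneous_section_def in_degree_def global_section_def
      zero_section_apply)

lemma homogeneous_section_add:
  assumes "a \<in> hcomp S (d * n)" "b \<in> hcomp S (d * n)"
  shows "homogeneous_section n a \<oplus>\<^bsub>A\<^esub> homogeneous_section n b = homogeneous_section n (a \<oplus> b)"
proof (rule section_eqI)
  fix P assume P: "P \<in> Proj S"
  interpret UP_cring "R\<^sub>P P" "UP (R\<^sub>P P)"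
    by (rule UP_cring.intro[OF cring_stalk[OF P]])
  note hom = hcomp_carrier[OF assms(1)] hcomp_carrier[OF assms(2)]
  show "(\<lambda>k. (homogeneous_section n a \<oplus>\<^bsub>A\<^esub> homogeneous_section n b) k P)
      = (\<lambda>k. homogeneous_section n (a \<oplus> b) k P)"
    using assms hom P ring_hom_closed[OF germ_ring_hom[OF P]]
    by (simp add: germs_add homogeneous_section_carrier germs_homogeneous_section
        ring_hom_add[OF germ_ring_hom[OF P]])
qed (use assms in \<open>auto intro: section_algebra_add_closed homogeneous_section_carrier hcomp_add\<close>)

text \<open>
  At every point both factors are monomials in the polynomial ring over the ring of germs.
\<close>

lemma homogeneous_section_mult:
  assumes "a \<in> hcomp S (d * m)" "b \<in> hcomp S (d * n)"
  shows "homogeneous_section m a \<otimes>\<^bsub>A\<^esub> homogeneous_section n b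
    = homogeneous_section (m + n) (a \<otimes> b)"
proof (rule section_eqI)
  fix P assume P: "P \<in> Proj S"
  interpret UP_cring "R\<^sub>P P" "UP (R\<^sub>P P)"
    by (rule UP_cring.intro[OF cring_stalk[OF P]])
  note hom = hcomp_carrier[OF assms(1)] hcomp_carrier[OF assms(2)]
  show "(\<lambda>k. (homogeneous_section m a \<otimes>\<^bsub>A\<^esub> homogeneous_section n b) k P)
      = (\<lambda>k. homogeneous_section (m + n) (a \<otimes> b) k P)"
    using assms hom P ring_hom_closed[OF germ_ring_hom[OF P]]
    by (simp add: germs_mult homogeneous_section_carrier germs_homogeneous_section
        ring_hom_mult[OF germ_ring_hom[OF P]] monom_mult)
next
  show "homogeneous_section (m + n) (a \<otimes> b) \<in> carrier A"
    using hcomp_mult[OF assms] by (intro homogeneous_section_carrier) (simp add: distrib_left)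
qed (use assms in \<open>auto intro: section_algebra_mult_closed homogeneous_section_carrier\<close>)

text \<open>
  The dimension is built up by line extensions, so it can be read off from a chain \<open>E 0, E 1, \<dots>\<close> of
  subspaces in which \<open>E (Suc j)\<close> is spanned by \<open>E j\<close> and one new form \<open>w j\<close>. Newness is required of
  the section defined by \<open>w j\<close>, as different forms may define the same section.
\<close>

lemma has_dim_chain:
  assumes w: "\<And>j. j < r \<Longrightarrow> w j \<in> hcomp S (d * n)"
    and E0: "E 0 = {\<zero>}"
    and ESuc: "\<And>j. j < r \<Longrightarrow> E (Suc j) = {scal S c \<otimes> w j \<oplus> e | c e. e \<in> E j}"
    and indep: "\<And>j. j < r \<Longrightarrow> global_section (w j) \<notin> global_section ` E j"
  shows "has_dim A (homogeneous_section n ` E r) r"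
proof -
  interpret A: cring A by (rule cring_section_algebra)
  have E: "E j \<subseteq> hcomp S (d * n)" if "j \<le> r" for j
    using that
  proof (induction j)
    case 0
    then show ?case by (simp add: E0 hcomp_zero)
  next
    case (Suc j)
    have "scal S c \<otimes> w j \<in> hcomp S (d * n)" for c
      using hcomp_mult[OF scal_hcomp w, of j c] Suc.prems by simp
    then show ?case
      using Suc ESuc[of j] by (auto intro!: hcomp_add)
  qed
  have "A.dimension j (range (scal A)) (homogeneous_section n ` E j)" if "j \<le> r" for j
    using that
  proof (induction j)
    case 0
    then show ?case by (simp add: E0 homogeneous_section_zero)
  next
    case (Suc j)
    then have j: "j < r" by simp
    have "homogeneous_section n (scal S c \<otimes> w j \<oplus> e)
        = scal A c \<otimes>\<^bsub>A\<^esub> homogeneous_section n (w j) \<oplus>\<^bsub>A\<^esub> homogeneous_section n e"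
      if e: "e \<in> E j" for c e
    proof -
      have "scal S c \<otimes> w j \<in> hcomp S (d * n)"
        using hcomp_mult[OF scal_hcomp w[OF j], of c] by simp
      then have "homogeneous_section n (scal S c \<otimes> w j \<oplus> e)
          = homogeneous_section (0 + n) (scal S c \<otimes> w j) \<oplus>\<^bsub>A\<^esub> homogeneous_section n e"
        using E[of j] j e by (simp add: homogeneous_section_add subset_iff)
      then show ?thesis
        using homogeneous_section_mult[of "scal S c" 0 "w j" n] scal_hcomp[of c] w[OF j]
        by (simp add: scal_eq_homogeneous_section)
    qed
    note sec = this
    have ext: "homogeneous_section n ` E (Suc j) =
        A.line_extension (range (scal A)) (homogeneous_section n (w j)) (homogeneous_section n ` E j)"
    proof (intro equalityI subsetI)
      fix u assume "u \<in> homogeneous_section n ` E (Suc j)"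
      then obtain c e where e: "e \<in> E j" and u: "u = homogeneous_section n (scal S c \<otimes> w j \<oplus> e)"
        unfolding ESuc[OF j] by (elim imageE) (simp only: mem_Collect_eq, metis)
      show "u \<in> A.line_extension (range (scal A)) (homogeneous_section n (w j)) (homogeneous_section n ` E j)"
        unfolding u sec[OF e] A.line_extension_mem_iff using e by blast
    next
      fix u
      assume "u \<in> A.line_extension (range (scal A)) (homogeneous_section n (w j)) (homogeneous_section n ` E j)"
      then obtain c e where e: "e \<in> E j"
          and u: "u = scal A c \<otimes>\<^bsub>A\<^esub> homogeneous_section n (w j) \<oplus>\<^bsub>A\<^esub> homogeneous_section n e"
        unfolding A.line_extension_mem_iff by blast
      show "u \<in> homogeneous_section n ` E (Suc j)"
        unfolding u sec[OF e, symmetric] ESuc[OF j] using e by (intro imageI CollectI) metis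
    qed
    have "homogeneous_section n (w j) \<notin> homogeneous_section n ` E j"
      using indep[OF j] by (auto simp: image_iff homogeneous_section_eq_iff)
    then show ?case
      unfolding ext using Suc j by (intro A.Suc_dim homogeneous_section_carrier w) auto
  qed
  then show ?thesis by (simp add: has_dim_def)
qed

text \<open>
  The partial sums of the homogeneous decomposition truncate \<open>y\<close>, so they reach \<open>y\<close> once the
  bound exceeds its support.
\<close>

lemma finsum_in_degree:
  assumes "y \<in> carrier A"
  shows "finsum A (\<lambda>n. in_degree n (y n)) {..N} = (\<lambda>m. if m \<le> N then y m else zero_section S)"
proof -
  interpret A: cring A by (rule cring_section_algebra)
  have carr: "in_degree n (y n) \<in> carrier A" for n
    using in_degree_hcomp[OF section_component[OF assms]] by (simp add: section_algebra_hcomp)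
  have add_zero: "(\<lambda>P\<in>Proj S. f P \<oplus>\<^bsub>R\<^sub>P P\<^esub> zero_section S P) = f"
      "(\<lambda>P\<in>Proj S. zero_section S P \<oplus>\<^bsub>R\<^sub>P P\<^esub> f P) = f"
    if f: "f \<in> twist_sections S l (Proj S)" for f l
  proof -
    have "f P \<oplus>\<^bsub>R\<^sub>P P\<^esub> zero_section S P = f P \<and> zero_section S P \<oplus>\<^bsub>R\<^sub>P P\<^esub> f P = f P"
      if P: "P \<in> Proj S" for P
    proof -
      interpret loc: cring "R\<^sub>P P" by (rule cring_stalk[OF P])
      show ?thesis using twist_sections_carrier[OF f P] P by (simp add: zero_section_apply)
    qed
    then show "(\<lambda>P\<in>Proj S. f P \<oplus>\<^bsub>R\<^sub>P P\<^esub> zero_section S P) = f"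
      "(\<lambda>P\<in>Proj S. zero_section S P \<oplus>\<^bsub>R\<^sub>P P\<^esub> f P) = f"
      using twist_sections_extensional[OF f]
      by (auto intro!: extensionalityI[of _ "Proj S"])
  qed
  show ?thesis
  proof (induction N)
    case 0
    show ?case using carr by (auto simp: in_degree_def)
  next
    case (Suc N)
    have "finsum A (\<lambda>n. in_degree n (y n)) {..Suc N}
        = in_degree (Suc N) (y (Suc N)) \<oplus>\<^bsub>A\<^esub> (\<lambda>m. if m \<le> N then y m else zero_section S)"
      using carr by (subst A.finsum_Suc) (auto simp: Suc.IH)
    also have "\<dots> = (\<lambda>m. if m \<le> Suc N then y m else zero_section S)"
    proof (rule ext)
      fix m
      consider "m \<le> N" | "m = Suc N" | "m > Suc N" by linarith
      then show "(in_degree (Suc N) (y (Suc N)) \<oplus>\<^bsub>A\<^esub> (\<lambda>m. if m \<le> N then y m else zero_section S)) m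
          = (if m \<le> Suc N then y m else zero_section S)"
        unfolding section_algebra_add
        using add_zero[OF section_component[OF assms, of m]] add_zero[OF zero_section_twist]
        by cases (simp_all add: in_degree_def)
    qed
    finally show ?case .
  qed
qed

text \<open>
  For a graded subalgebra \<open>B 0, B 1, \<dots>\<close> of the \<open>d\<close>-th Veronese subring, with \<open>B n\<close> in degree \<open>d n\<close>, the
  elements below form a graded linear series.
\<close>

definition series_of :: "(nat \<Rightarrow> 'a set) \<Rightarrow> (nat \<Rightarrow> 'a set \<Rightarrow> ('a \<times> 'a) set) set" where
  "series_of B = {y \<in> carrier A. \<forall>n. y n \<in> global_section ` B n}"

context
  fixes B :: "nat \<Rightarrow> 'a set"
  assumes B_hcomp: "B n \<subseteq> hcomp S (d * n)"
    and B_zero: "\<zero> \<in> B n"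
    and B_add: "a \<in> B n \<Longrightarrow> b \<in> B n \<Longrightarrow> a \<oplus> b \<in> B n"
    and B_neg: "a \<in> B n \<Longrightarrow> \<ominus> a \<in> B n"
    and B_mult: "a \<in> B m \<Longrightarrow> b \<in> B n \<Longrightarrow> a \<otimes> b \<in> B (m + n)"
    and B_scal: "scal S c \<in> B 0"
begin

lemma series_of_component:
  assumes "y \<in> series_of B"
  obtains a where "a \<in> B n" "y n = global_section a"
  using assms unfolding series_of_def by blast

lemma B_carrier: "a \<in> B n \<Longrightarrow> a \<in> carrier S"
  using B_hcomp hcomp_carrier by blast

lemma B_finsum: "finite I \<Longrightarrow> (\<And>i. i \<in> I \<Longrightarrow> f i \<in> B n) \<Longrightarrow> finsum S f I \<in> B n"
proof (induction I rule: finite_induct)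
  case empty
  show ?case by (simp add: B_zero)
next
  case (insert i I)
  have "finsum S f (insert i I) = f i \<oplus> finsum S f I"
    using insert.hyps insert.prems B_carrier by (intro finsum_insert) auto
  then show ?case
    using insert.IH insert.prems B_add by simp
qed

lemma homogeneous_section_series: "a \<in> B n \<Longrightarrow> homogeneous_section n a \<in> series_of B"
  using homogeneous_section_carrier[of a n] B_hcomp[of n] B_zero
  by (auto simp: series_of_def homogeneous_section_def in_degree_def zero_section_global)

lemma series_of_hcomp: "series_of B \<inter> hcomp A n = homogeneous_section n ` B n"
proof
  show "series_of B \<inter> hcomp A n \<subseteq> homogeneous_section n ` B n"
  proof
    fix y assume y: "y \<in> series_of B \<inter> hcomp A n"
    then obtain a where "a \<in> B n" "y n = global_section a"
      by (auto simp: series_of_def)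
    then show "y \<in> homogeneous_section n ` B n"
      using y hcomp_in_degree[of y n] by (auto simp: homogeneous_section_def)
  qed
  show "homogeneous_section n ` B n \<subseteq> series_of B \<inter> hcomp A n"
    using homogeneous_section_series homogeneous_section_hcomp B_hcomp by blast
qed

text \<open>
  Passing from a form to its germ is a ring homomorphism, so a component of the product is given by
  the form \<open>b\<^sub>0 c\<^sub>n + \<dots> + b\<^sub>n c\<^sub>0\<close>, which lies in \<open>B n\<close>.
\<close>

lemma series_of_mult:
  assumes "y \<in> series_of B" "z \<in> series_of B"
  shows "y \<otimes>\<^bsub>A\<^esub> z \<in> series_of B"
proof -
  have yz: "y \<in> carrier A" "z \<in> carrier A"
    using assms by (auto simp: series_of_def)
  have "\<forall>n. \<exists>a. a \<in> B n \<and> y n = global_section a" "\<forall>n. \<exists>a. a \<in> B n \<and> z n = global_section a"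
    using assms by (auto simp: series_of_def)
  then obtain b c where b: "\<And>n. b n \<in> B n" "\<And>n. y n = global_section (b n)"
    and c: "\<And>n. c n \<in> B n" "\<And>n. z n = global_section (c n)"
    by metis
  have "(y \<otimes>\<^bsub>A\<^esub> z) n \<in> global_section ` B n" for n
  proof -
    have bc: "b i \<otimes> c (n - i) \<in> B n" if "i \<in> {..n}" for i
      using B_mult[OF b(1)[of i] c(1)[of "n - i"]] that by simp
    have "(y \<otimes>\<^bsub>A\<^esub> z) n = global_section (\<Oplus>i\<in>{..n}. b i \<otimes> c (n - i))"
      unfolding section_algebra_mult global_section_def
    proof (rule restrict_ext)
      fix P assume P: "P \<in> Proj S"
      interpret loc: cring "R\<^sub>P P" by (rule cring_stalk[OF P])
      interpret h: ring_hom_cring S "R\<^sub>P P" "\<lambda>a. germ P a \<one>"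
        by (intro ring_hom_cring.intro ring_hom_cring_axioms.intro cring_axioms loc.cring_axioms
            germ_ring_hom P)
      have "germ P (\<Oplus>i\<in>{..n}. b i \<otimes> c (n - i)) \<one>
          = finsum (R\<^sub>P P) ((\<lambda>a. germ P a \<one>) \<circ> (\<lambda>i. b i \<otimes> c (n - i))) {..n}"
        using bc B_carrier by (intro h.hom_finsum) auto
      also have "\<dots> = finsum (R\<^sub>P P) (\<lambda>i. y i P \<otimes>\<^bsub>R\<^sub>P P\<^esub> z (n - i) P) {..n}"
        using b(2) c(2) B_carrier[OF b(1)] B_carrier[OF c(1)] P
        by (simp add: global_section_def comp_def)
      finally show "finsum (R\<^sub>P P) (\<lambda>i. y i P \<otimes>\<^bsub>R\<^sub>P P\<^esub> z (n - i) P) {..n}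
          = germ P (\<Oplus>i\<in>{..n}. b i \<otimes> c (n - i)) \<one>" by simp
    qed
    then show ?thesis
      using bc by (auto intro!: imageI B_finsum)
  qed
  then show ?thesis
    using section_algebra_mult_closed[OF yz] by (simp add: series_of_def)
qed

lemma series_of_add:
  assumes "y \<in> series_of B" "z \<in> series_of B"
  shows "y \<oplus>\<^bsub>A\<^esub> z \<in> series_of B"
proof -
  have "(y \<oplus>\<^bsub>A\<^esub> z) n \<in> global_section ` B n" for n
  proof -
    obtain a where a: "a \<in> B n" "y n = global_section a"
      using series_of_component[OF assms(1)] .
    obtain b where b: "b \<in> B n" "z n = global_section b"
      using series_of_component[OF assms(2)] .
    have "(y \<oplus>\<^bsub>A\<^esub> z) n = global_section (a \<oplus> b)"
      using global_section_add[OF B_carrier[OF a(1)] B_carrier[OF b(1)]]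
      by (simp add: section_algebra_add a(2) b(2))
    then show ?thesis using B_add[OF a(1) b(1)] by blast
  qed
  then show ?thesis
    using section_algebra_add_closed assms by (simp add: series_of_def)
qed

lemma graded_linear_series_of: "graded_linear_series S d (series_of B)"
proof -
  interpret A: cring A by (rule cring_section_algebra)
  have sub: "series_of B \<subseteq> carrier A"
    by (auto simp: series_of_def)
  have scal: "scal A c \<in> series_of B" for c
    unfolding scal_eq_homogeneous_section by (intro homogeneous_section_series B_scal)
  have "\<one>\<^bsub>A\<^esub> = scal A 1"
    by (simp add: section_algebra_one section_algebra_scal scal_one)
  then have one: "\<one>\<^bsub>A\<^esub> \<in> series_of B" by (simp add: scal)
  have neg: "\<ominus>\<^bsub>A\<^esub> y \<in> series_of B" if y: "y \<in> series_of B" for y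
  proof -
    have m: "homogeneous_section 0 (\<ominus> \<one>) \<in> series_of B"
      using B_neg[OF B_scal[of 1]] by (intro homogeneous_section_series) (simp add: scal_one)
    have "homogeneous_section 0 (\<ominus> \<one>) \<oplus>\<^bsub>A\<^esub> \<one>\<^bsub>A\<^esub> = \<zero>\<^bsub>A\<^esub>"
      using homogeneous_section_add[of "\<ominus> \<one>" 0 \<one>] hcomp_one hcomp_neg[OF hcomp_one]
      by (simp add: section_algebra_one homogeneous_section_def[symmetric] l_neg
          homogeneous_section_zero)
    then have "\<ominus>\<^bsub>A\<^esub> \<one>\<^bsub>A\<^esub> = homogeneous_section 0 (\<ominus> \<one>)"
      using m sub by (intro A.minus_equality) auto
    then have "\<ominus>\<^bsub>A\<^esub> y = homogeneous_section 0 (\<ominus> \<one>) \<otimes>\<^bsub>A\<^esub> y"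
      using sub y A.l_minus[of "\<one>\<^bsub>A\<^esub>" y] by auto
    then show ?thesis using series_of_mult[OF m y] by simp
  qed
  have "subring (series_of B) A"
    by (rule A.subringI[OF sub one neg series_of_mult series_of_add])
  moreover have "\<exists>z N. (\<forall>n. z n \<in> series_of B \<inter> hcomp A n) \<and> y = finsum A z {..(N::nat)}"
    if y: "y \<in> series_of B" for y
  proof -
    have yA: "y \<in> carrier A" using sub y by blast
    obtain N where N: "\<And>n. y n \<noteq> zero_section S \<Longrightarrow> n \<le> N"
      using yA finite_nat_set_iff_bounded_le[of "{n. y n \<noteq> zero_section S}"]
      by (auto simp: mem_section_algebra)
    have sum: "y = finsum A (\<lambda>n. in_degree n (y n)) {..N}"
      unfolding finsum_in_degree[OF yA] using N by (intro ext) metis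
    have mem: "in_degree n (y n) \<in> series_of B \<inter> hcomp A n" for n
    proof -
      obtain a where "a \<in> B n" "y n = global_section a"
        using series_of_component[OF y] .
      then show ?thesis
        unfolding series_of_hcomp by (auto simp: homogeneous_section_def)
    qed
    show ?thesis
      by (intro exI[of _ "\<lambda>n. in_degree n (y n)"] exI[of _ N] conjI allI mem sum)
  qed
  moreover have "range (scal A) \<subseteq> series_of B"
    using scal by blast
  ultimately show ?thesis
    unfolding graded_linear_series_def graded_subalgebra_def by (intro conjI ballI)
qed

end
end
end

section \<open>Nilpotent graded linear series\<close>

text \<open>
  If homogeneous elements of positive degree square to zero, then the polynomial \<open>Y\<^sub>0\<^sup>2\<close> is a relation
  for every nonempty family of them, so no such family is algebraically independent.
\<close>

lemma kodaira_iitaka_dim_nilpotent: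
  fixes A :: "('k::field, 'a, 'z) graded_algebra_scheme"
  assumes "cring A" and scal: "\<And>c. scal A c \<in> carrier A"
    and nil: "\<And>n y. n > 0 \<Longrightarrow> y \<in> L \<inter> hcomp A n \<Longrightarrow> y \<in> carrier A \<and> y \<otimes>\<^bsub>A\<^esub> y = \<zero>\<^bsub>A\<^esub>"
  shows "kodaira_iitaka_dim A L = - \<infinity>"
proof -
  interpret cring A by fact
  have "m = 0" if y: "\<forall>i<m. \<exists>n>0. y i \<in> L \<inter> hcomp A n" and indep: "algebraically_independent A m y"
    for m y
  proof (rule ccontr)
    assume "m \<noteq> 0"
    have yc: "y i \<in> carrier A" if "i < m" for i
      using y nil that by blast
    have y0: "y 0 \<otimes>\<^bsub>A\<^esub> y 0 = \<zero>\<^bsub>A\<^esub>"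
      using y nil \<open>m \<noteq> 0\<close> by blast
    define e :: "nat \<Rightarrow>\<^sub>0 nat" where "e = Poly_Mapping.single 0 2"
    define F :: "(nat \<Rightarrow>\<^sub>0 nat) \<Rightarrow>\<^sub>0 'k" where "F = Poly_Mapping.single e 1"
    \<comment> \<open>Evaluating \<open>Y\<^sub>0\<^sup>2\<close> gives a product whose factor of index \<open>0\<close> is \<open>y 0\<close> squared.\<close>
    let ?f = "\<lambda>i. y i [^]\<^bsub>A\<^esub> Poly_Mapping.lookup e i"
    have "finprod A ?f {..<m} = finprod A ?f (insert 0 ({..<m} - {0}))"
      using \<open>m \<noteq> 0\<close> by (simp add: insert_absorb)
    also have "\<dots> = ?f 0 \<otimes>\<^bsub>A\<^esub> finprod A ?f ({..<m} - {0})"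
      using yc \<open>m \<noteq> 0\<close> by (intro finprod_insert) auto
    also have "?f 0 = \<zero>\<^bsub>A\<^esub>"
      using y0 yc[of 0] \<open>m \<noteq> 0\<close> by (simp add: e_def numeral_2_eq_2)
    also have "\<zero>\<^bsub>A\<^esub> \<otimes>\<^bsub>A\<^esub> finprod A ?f ({..<m} - {0}) = \<zero>\<^bsub>A\<^esub>"
      using yc by (intro l_null finprod_closed) auto
    finally have "eval_poly A m y F = \<zero>\<^bsub>A\<^esub>"
      using scal by (simp add: eval_poly_def F_def)
    moreover have "\<forall>e\<in>Poly_Mapping.keys F. Poly_Mapping.keys e \<subseteq> {..<m}"
      using \<open>m \<noteq> 0\<close> by (simp add: F_def e_def del: single_numeral)
    ultimately have "F = 0"
      using indep unfolding algebraically_independent_def by blast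
    then have "Poly_Mapping.lookup F e = 0" by simp
    then show False by (simp add: F_def)
  qed
  then have "sigma A L \<le> 0"
    unfolding sigma_def by (auto intro!: Sup_least simp: zero_enat_def)
  then show ?thesis
    by (simp add: kodaira_iitaka_dim_def)
qed

section \<open>Quotients and polynomial rings as graded algebras\<close>

lemma cring_quotient_algebra:
  assumes "cring R" "ideal I R"
  shows "cring (quotient_algebra R I)"
proof -
  interpret Q: cring "R Quot I" using ideal.quotient_is_cring[OF assms(2,1)] .
  show ?thesis
  proof (intro cringI abelian_groupI comm_monoidI)
    fix x assume "x \<in> carrier (quotient_algebra R I)"
    then show "\<exists>y\<in>carrier (quotient_algebra R I). y \<oplus>\<^bsub>quotient_algebra R I\<^esub> x = \<zero>\<^bsub>quotient_algebra R I\<^esub>"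
      by (intro bexI[of _ "\<ominus>\<^bsub>R Quot I\<^esub> x"]) (simp_all add: quotient_algebra_def Q.l_neg)
  qed (simp_all add: quotient_algebra_def Q.a_ac Q.m_ac Q.l_distr Q.r_distr)
qed

lemma quotient_algebra_ring_hom:
  assumes "ideal I R"
  shows "(+>\<^bsub>R\<^esub>) I \<in> ring_hom R (quotient_algebra R I)"
  using ideal.rcos_ring_hom[OF assms]
  by (simp add: ring_hom_def quotient_algebra_def)

text \<open>
  The components and the structure map of the quotient are images under the quotient homomorphism,
  through which all the axioms are transported.
\<close>

lemma graded_quotient_algebra:
  assumes "graded_comm_algebra R" "ideal I R"
  shows "graded_comm_algebra (quotient_algebra R I)"
proof -
  interpret R: graded_comm_algebra R by fact
  interpret Q: cring "quotient_algebra R I"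
    by (rule cring_quotient_algebra[OF R.cring_axioms assms(2)])
  interpret h: ring_hom_cring R "quotient_algebra R I" "(+>\<^bsub>R\<^esub>) I"
    by (intro ring_hom_cring.intro ring_hom_cring_axioms.intro R.cring_axioms Q.cring_axioms
        quotient_algebra_ring_hom[OF assms(2)])
  let ?Q = "quotient_algebra R I"
  have hc: "hcomp ?Q n = (+>\<^bsub>R\<^esub>) I ` hcomp R n" for n
    by (simp add: quotient_algebra_def)
  have sc: "scal ?Q c = I +>\<^bsub>R\<^esub> scal R c" for c
    by (simp add: quotient_algebra_def)
  have scR: "scal R c \<in> carrier R" for c
    using R.hcomp_carrier[OF R.scal_hcomp] .
  show ?thesis
  proof (intro graded_comm_algebra.intro graded_comm_algebra_axioms.intro Q.cring_axioms)
    fix a n assume "a \<in> hcomp ?Q n"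
    then obtain f where f: "f \<in> hcomp R n" "a = I +>\<^bsub>R\<^esub> f"
      unfolding hc by blast
    show "a \<in> carrier ?Q"
      unfolding f(2) by (intro h.hom_closed R.hcomp_carrier[OF f(1)])
    have "\<ominus>\<^bsub>?Q\<^esub> a = I +>\<^bsub>R\<^esub> (\<ominus>\<^bsub>R\<^esub> f)"
      unfolding f(2) by (rule h.hom_a_inv[OF R.hcomp_carrier[OF f(1)], symmetric])
    then show "\<ominus>\<^bsub>?Q\<^esub> a \<in> hcomp ?Q n"
      unfolding hc using R.hcomp_neg[OF f(1)] by blast
  next
    fix a b n assume "a \<in> hcomp ?Q n" "b \<in> hcomp ?Q n"
    then obtain f g where f: "f \<in> hcomp R n" "a = I +>\<^bsub>R\<^esub> f" and g: "g \<in> hcomp R n" "b = I +>\<^bsub>R\<^esub> g"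
      unfolding hc by blast
    have "a \<oplus>\<^bsub>?Q\<^esub> b = I +>\<^bsub>R\<^esub> (f \<oplus>\<^bsub>R\<^esub> g)"
      unfolding f(2) g(2)
      by (rule h.hom_add[OF R.hcomp_carrier[OF f(1)] R.hcomp_carrier[OF g(1)], symmetric])
    then show "a \<oplus>\<^bsub>?Q\<^esub> b \<in> hcomp ?Q n"
      unfolding hc using R.hcomp_add[OF f(1) g(1)] by blast
  next
    fix a b m n assume "a \<in> hcomp ?Q m" "b \<in> hcomp ?Q n"
    then obtain f g where f: "f \<in> hcomp R m" "a = I +>\<^bsub>R\<^esub> f" and g: "g \<in> hcomp R n" "b = I +>\<^bsub>R\<^esub> g"
      unfolding hc by blast
    have "a \<otimes>\<^bsub>?Q\<^esub> b = I +>\<^bsub>R\<^esub> (f \<otimes>\<^bsub>R\<^esub> g)"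
      unfolding f(2) g(2)
      by (rule h.hom_mult[OF R.hcomp_carrier[OF f(1)] R.hcomp_carrier[OF g(1)], symmetric])
    then show "a \<otimes>\<^bsub>?Q\<^esub> b \<in> hcomp ?Q (m + n)"
      unfolding hc using R.hcomp_mult[OF f(1) g(1)] by blast
  next
    fix n
    show "\<zero>\<^bsub>?Q\<^esub> \<in> hcomp ?Q n"
      unfolding hc h.hom_zero[symmetric] using R.hcomp_zero by (rule imageI)
  next
    show "\<one>\<^bsub>?Q\<^esub> \<in> hcomp ?Q 0"
      unfolding hc h.hom_one[symmetric] using R.hcomp_one by (rule imageI)
  next
    fix c c'
    show "scal ?Q c \<in> hcomp ?Q 0"
      unfolding hc sc using R.scal_hcomp by (rule imageI)
    show "scal ?Q (c + c') = scal ?Q c \<oplus>\<^bsub>?Q\<^esub> scal ?Q c'"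
      unfolding sc R.scal_add by (rule h.hom_add[OF scR scR])
    show "scal ?Q (c * c') = scal ?Q c \<otimes>\<^bsub>?Q\<^esub> scal ?Q c'"
      unfolding sc R.scal_mult by (rule h.hom_mult[OF scR scR])
    show "scal ?Q 1 = \<one>\<^bsub>?Q\<^esub>"
      unfolding sc R.scal_one by (rule h.hom_one)
  qed
qed

lemma cring_polynomial_algebra:
  "cring (polynomial_algebra :: ('k::field, ('v \<Rightarrow>\<^sub>0 nat) \<Rightarrow>\<^sub>0 'k) graded_algebra)"
proof (intro cringI abelian_groupI comm_monoidI)
  fix f :: "('v \<Rightarrow>\<^sub>0 nat) \<Rightarrow>\<^sub>0 'k"
  show "\<exists>g\<in>carrier polynomial_algebra. g \<oplus>\<^bsub>polynomial_algebra\<^esub> f = \<zero>\<^bsub>polynomial_algebra\<^esub>"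
    by (intro bexI[of _ "- f"]) (simp_all add: polynomial_algebra_def)
qed (simp_all add: polynomial_algebra_def algebra_simps)

definition monomial_degree :: "('v \<Rightarrow>\<^sub>0 nat) \<Rightarrow> nat" where
  "monomial_degree e = (\<Sum>i\<in>Poly_Mapping.keys e. Poly_Mapping.lookup e i)"

lemma monomial_degree_superset:
  assumes "finite K" "Poly_Mapping.keys e \<subseteq> K"
  shows "monomial_degree e = (\<Sum>i\<in>K. Poly_Mapping.lookup e i)"
  unfolding monomial_degree_def using assms
  by (intro sum.mono_neutral_left) (auto simp: in_keys_iff)

lemma monomial_degree_add: "monomial_degree (e + e') = monomial_degree e + monomial_degree e'"
proof -
  let ?K = "Poly_Mapping.keys e \<union> Poly_Mapping.keys e'"
  have "monomial_degree (e + e') = (\<Sum>i\<in>?K. Poly_Mapping.lookup (e + e') i)"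
    by (rule monomial_degree_superset) (use keys_add[of e e'] in auto)
  also have "\<dots> = monomial_degree e + monomial_degree e'"
    by (simp add: lookup_add sum.distrib monomial_degree_superset[of ?K])
  finally show ?thesis .
qed

lemma monomial_degree_single: "monomial_degree (Poly_Mapping.single i n) = n"
  by (simp add: monomial_degree_def)

lemma hcomp_polynomial_algebra:
  "f \<in> hcomp polynomial_algebra d \<longleftrightarrow> (\<forall>e\<in>Poly_Mapping.keys f. monomial_degree e = d)"
  by (simp add: polynomial_algebra_def monomial_degree_def)

lemma polynomial_algebra_neg: "\<ominus>\<^bsub>polynomial_algebra\<^esub> f = - f"
proof -
  interpret cring polynomial_algebra by (rule cring_polynomial_algebra)
  show ?thesis
    by (rule minus_equality) (simp_all add: polynomial_algebra_def)
qed

lemma graded_polynomial_algebra: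
  "graded_comm_algebra (polynomial_algebra :: ('k::field, ('v \<Rightarrow>\<^sub>0 nat) \<Rightarrow>\<^sub>0 'k) graded_algebra)"
proof (intro graded_comm_algebra.intro graded_comm_algebra_axioms.intro cring_polynomial_algebra)
  fix f g :: "('v \<Rightarrow>\<^sub>0 nat) \<Rightarrow>\<^sub>0 'k" and m n
  show "f \<oplus>\<^bsub>polynomial_algebra\<^esub> g \<in> hcomp polynomial_algebra n"
    if "f \<in> hcomp polynomial_algebra n" "g \<in> hcomp polynomial_algebra n"
  proof -
    have "f \<oplus>\<^bsub>polynomial_algebra\<^esub> g = f + g" by (simp add: polynomial_algebra_def)
    then show ?thesis
      using that keys_add[of f g] unfolding hcomp_polynomial_algebra by auto
  qed
  show "f \<otimes>\<^bsub>polynomial_algebra\<^esub> g \<in> hcomp polynomial_algebra (m + n)"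
    if "f \<in> hcomp polynomial_algebra m" "g \<in> hcomp polynomial_algebra n"
  proof -
    have "f \<otimes>\<^bsub>polynomial_algebra\<^esub> g = f * g" by (simp add: polynomial_algebra_def)
    then show ?thesis
      using that keys_mult[of f g] monomial_degree_add unfolding hcomp_polynomial_algebra by fastforce
  qed
  show "\<ominus>\<^bsub>polynomial_algebra\<^esub> f \<in> hcomp polynomial_algebra n" if "f \<in> hcomp polynomial_algebra n"
    using that unfolding polynomial_algebra_neg hcomp_polynomial_algebra
    by (simp add: in_keys_iff)
qed (simp_all add: polynomial_algebra_def single_add mult_single)

section \<open>The polynomial ring modulo the square of a variable\<close>

abbreviation x\<^sub>1 :: "(3 \<Rightarrow>\<^sub>0 nat) \<Rightarrow>\<^sub>0 'k::field" where
  "x\<^sub>1 \<equiv> poly_var 1"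

lemma sum_monomials: "f = (\<Sum>e\<in>Poly_Mapping.keys f. Poly_Mapping.single e (Poly_Mapping.lookup f e))"
  by (rule poly_mapping_eqI)
    (simp add: lookup_sum lookup_single when_def in_keys_iff)

text \<open>
  A polynomial is divisible by \<open>x\<^sub>1\<close> as soon as each of its monomials is, for it is their sum.
\<close>

lemma x1_dvd_iff:
  fixes f :: "(3 \<Rightarrow>\<^sub>0 nat) \<Rightarrow>\<^sub>0 'k::field"
  shows "x\<^sub>1 dvd f \<longleftrightarrow> (\<forall>e\<in>Poly_Mapping.keys f. Poly_Mapping.lookup e 1 \<noteq> 0)"
proof
  assume "x\<^sub>1 dvd f"
  then obtain q where "f = x\<^sub>1 * q" ..
  then show "\<forall>e\<in>Poly_Mapping.keys f. Poly_Mapping.lookup e 1 \<noteq> 0"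
    using keys_mult[of x\<^sub>1 q] by (auto simp: poly_var_def lookup_add)
next
  assume keys: "\<forall>e\<in>Poly_Mapping.keys f. Poly_Mapping.lookup e 1 \<noteq> 0"
  have "x\<^sub>1 dvd Poly_Mapping.single e (Poly_Mapping.lookup f e)" if "e \<in> Poly_Mapping.keys f" for e
  proof -
    have "e = Poly_Mapping.single 1 1 + (e - Poly_Mapping.single 1 1)"
      using keys that by (intro poly_mapping_eqI) (auto simp: lookup_add lookup_minus lookup_single when_def)
    then have "Poly_Mapping.single e (Poly_Mapping.lookup f e)
        = x\<^sub>1 * Poly_Mapping.single (e - Poly_Mapping.single 1 1) (Poly_Mapping.lookup f e)"
      by (simp add: poly_var_def mult_single)
    then show ?thesis by simp
  qed
  then show "x\<^sub>1 dvd f"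
    by (subst sum_monomials) (rule dvd_sum)
qed

lemma x1_square_dvd:
  fixes f :: "(3 \<Rightarrow>\<^sub>0 nat) \<Rightarrow>\<^sub>0 'k::field"
  assumes "x\<^sub>1\<^sup>2 dvd f" "e \<in> Poly_Mapping.keys f"
  shows "2 \<le> Poly_Mapping.lookup e 1"
proof -
  obtain q where f: "f = x\<^sub>1\<^sup>2 * q" using assms(1) ..
  have "x\<^sub>1\<^sup>2 = (Poly_Mapping.single (Poly_Mapping.single 1 2) 1 :: (3 \<Rightarrow>\<^sub>0 nat) \<Rightarrow>\<^sub>0 'k)"
    by (simp add: poly_var_def power2_eq_square mult_single numeral_2_eq_2 flip: single_add)
  then show ?thesis
    using keys_mult[of "x\<^sub>1\<^sup>2" q] assms(2) unfolding f by (auto simp: lookup_add)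
qed

text \<open>
  Modulo \<open>x\<^sub>1\<close> every polynomial is congruent to one that is free of \<open>x\<^sub>1\<close>. The product of two such
  representatives is free of \<open>x\<^sub>1\<close> as well, hence divisible by \<open>x\<^sub>1\<close> only if it is zero, and polynomials
  over a field have no zero divisors.
\<close>

lemma x1_prime:
  fixes f g :: "(3 \<Rightarrow>\<^sub>0 nat) \<Rightarrow>\<^sub>0 'k::field"
  assumes "x\<^sub>1 dvd f * g"
  shows "x\<^sub>1 dvd f \<or> x\<^sub>1 dvd g"
proof -
  have split: "\<exists>r. x\<^sub>1 dvd f - r \<and> (\<forall>e\<in>Poly_Mapping.keys r. Poly_Mapping.lookup e 1 = 0)"
    for f :: "(3 \<Rightarrow>\<^sub>0 nat) \<Rightarrow>\<^sub>0 'k"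
  proof -
    let ?K = "{e \<in> Poly_Mapping.keys f. Poly_Mapping.lookup e 1 = 0}"
    define r where "r = (\<Sum>e\<in>?K. Poly_Mapping.single e (Poly_Mapping.lookup f e))"
    have r: "Poly_Mapping.lookup r e = (if Poly_Mapping.lookup e 1 = 0 then Poly_Mapping.lookup f e else 0)" for e
      by (simp add: r_def lookup_sum lookup_single when_def in_keys_iff)
    show ?thesis
      by (intro exI[of _ r]) (auto simp: x1_dvd_iff in_keys_iff lookup_minus r split: if_splits)
  qed
  obtain r s where r: "x\<^sub>1 dvd f - r" "\<forall>e\<in>Poly_Mapping.keys r. Poly_Mapping.lookup e 1 = 0"
    and s: "x\<^sub>1 dvd g - s" "\<forall>e\<in>Poly_Mapping.keys s. Poly_Mapping.lookup e 1 = 0"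
    using split[of f] split[of g] by blast
  have "r * s = f * g - ((f - r) * g + r * (g - s))"
    by (simp add: algebra_simps)
  then have "x\<^sub>1 dvd r * s"
    using assms r(1) s(1) by simp
  moreover have "Poly_Mapping.lookup e 1 = 0" if "e \<in> Poly_Mapping.keys (r * s)" for e
    using that keys_mult[of r s] r(2) s(2) by (auto simp: lookup_add)
  ultimately have "Poly_Mapping.keys (r * s) = {}"
    unfolding x1_dvd_iff by blast
  then have "r * s = 0" by simp
  then have "r = 0 \<or> s = 0" by simp
  then show ?thesis using r(1) s(1) by auto
qed

lemma x1_nonzero: "(x\<^sub>1 :: (3 \<Rightarrow>\<^sub>0 nat) \<Rightarrow>\<^sub>0 'k::field) \<noteq> 0"
proof -
  have "Poly_Mapping.keys (x\<^sub>1 :: (3 \<Rightarrow>\<^sub>0 nat) \<Rightarrow>\<^sub>0 'k) \<noteq> {}"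
    by (simp add: poly_var_def)
  then show ?thesis by auto
qed

text \<open>
  The ideal \<open>(x\<^sub>1\<^sup>2)\<close> is primary for \<open>(x\<^sub>1)\<close>: applying primeness twice pulls both factors \<open>x\<^sub>1\<close> out of \<open>f\<close>.
\<close>

lemma x1_square_dvd_mult_cancel:
  fixes u f :: "(3 \<Rightarrow>\<^sub>0 nat) \<Rightarrow>\<^sub>0 'k::field"
  assumes "x\<^sub>1\<^sup>2 dvd u * f" "\<not> x\<^sub>1 dvd u"
  shows "x\<^sub>1\<^sup>2 dvd f"
proof -
  obtain q where q: "u * f = x\<^sub>1\<^sup>2 * q" using assms(1) ..
  have "x\<^sub>1 dvd u * f" unfolding q by (simp add: power2_eq_square)
  then obtain h where h: "f = x\<^sub>1 * h" using x1_prime assms(2) by blast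
  have "x\<^sub>1 * (u * h) = x\<^sub>1 * (x\<^sub>1 * q)"
    using q unfolding h by (simp add: power2_eq_square ac_simps)
  then have "u * h = x\<^sub>1 * q"
    using x1_nonzero[where 'k='k] by simp
  then have "x\<^sub>1 dvd h" using x1_prime[of u h] assms(2) by auto
  then show ?thesis unfolding h by (simp add: power2_eq_square)
qed

section \<open>The double line\<close>

abbreviation double_line_ideal :: "((3 \<Rightarrow>\<^sub>0 nat) \<Rightarrow>\<^sub>0 'k::field) set" where
  "double_line_ideal \<equiv> genideal polynomial_algebra {x\<^sub>1\<^sup>2}"

definition residue_class :: "((3 \<Rightarrow>\<^sub>0 nat) \<Rightarrow>\<^sub>0 'k::field) \<Rightarrow> ((3 \<Rightarrow>\<^sub>0 nat) \<Rightarrow>\<^sub>0 'k) set" where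
  "residue_class f = double_line_ideal +>\<^bsub>polynomial_algebra\<^esub> f"

lemma double_line_ideal: "ideal double_line_ideal polynomial_algebra"
  by (intro ring.genideal_ideal cring.axioms(1) cring_polynomial_algebra)
    (simp add: polynomial_algebra_def)

interpretation dl: graded_comm_algebra
  "double_line_ring :: ('k::field, ((3 \<Rightarrow>\<^sub>0 nat) \<Rightarrow>\<^sub>0 'k) set) graded_algebra"
  unfolding double_line_ring_def
  by (rule graded_quotient_algebra[OF graded_polynomial_algebra double_line_ideal])

lemma mem_double_line_ideal: "f \<in> double_line_ideal \<longleftrightarrow> x\<^sub>1\<^sup>2 dvd f"
proof -
  have "double_line_ideal = cgenideal polynomial_algebra (x\<^sub>1\<^sup>2)"
    by (rule cring.cgenideal_eq_genideal[OF cring_polynomial_algebra, symmetric])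
      (simp add: polynomial_algebra_def)
  then show ?thesis
    by (auto simp: cgenideal_def polynomial_algebra_def dvd_def mult.commute)
qed

lemma residue_class_eq: "residue_class f = {g. x\<^sub>1\<^sup>2 dvd g - f}"
proof -
  have "residue_class f = {h + f | h. h \<in> double_line_ideal}"
    by (auto simp: residue_class_def a_r_coset_def r_coset_def polynomial_algebra_def)
  also have "\<dots> = {g. x\<^sub>1\<^sup>2 dvd g - f}"
  proof (intro equalityI subsetI)
    fix g assume "g \<in> {g. x\<^sub>1\<^sup>2 dvd g - f}"
    then show "g \<in> {h + f | h. h \<in> double_line_ideal}"
      unfolding mem_double_line_ideal mem_Collect_eq by (intro exI[of _ "g - f"]) simp
  qed (auto simp: mem_double_line_ideal)
  finally show ?thesis .
qed

lemma residue_class_eq_iff: "residue_class f = residue_class g \<longleftrightarrow> x\<^sub>1\<^sup>2 dvd f - g"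
proof
  assume "residue_class f = residue_class g"
  moreover have "f \<in> residue_class f" by (simp add: residue_class_eq)
  ultimately have "f \<in> residue_class g" by simp
  then show "x\<^sub>1\<^sup>2 dvd f - g" by (simp add: residue_class_eq)
next
  assume fg: "x\<^sub>1\<^sup>2 dvd f - g"
  have "x\<^sub>1\<^sup>2 dvd h - f \<longleftrightarrow> x\<^sub>1\<^sup>2 dvd h - g" for h
    using dvd_add_left_iff[OF fg, of "h - f"] by simp
  then show "residue_class f = residue_class g" by (simp add: residue_class_eq)
qed

lemma residue_class_ring_hom: "residue_class \<in> ring_hom polynomial_algebra double_line_ring"
  using quotient_algebra_ring_hom[OF double_line_ideal]
  by (simp add: residue_class_def[abs_def] double_line_ring_def)

lemma residue_class_add: "residue_class f \<oplus>\<^bsub>double_line_ring\<^esub> residue_class g = residue_class (f + g)"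
  using ring_hom_add[OF residue_class_ring_hom, of f g] by (simp add: polynomial_algebra_def)

lemma residue_class_mult: "residue_class f \<otimes>\<^bsub>double_line_ring\<^esub> residue_class g = residue_class (f * g)"
  using ring_hom_mult[OF residue_class_ring_hom, of f g] by (simp add: polynomial_algebra_def)

lemma residue_class_one: "\<one>\<^bsub>double_line_ring\<^esub> = residue_class 1"
  using ring_hom_one[OF residue_class_ring_hom, symmetric] by (simp add: polynomial_algebra_def)

lemma residue_class_closed: "residue_class f \<in> carrier double_line_ring"
  using ring_hom_closed[OF residue_class_ring_hom, of f] by (simp add: polynomial_algebra_def)

lemma residue_class_zero: "\<zero>\<^bsub>double_line_ring\<^esub> = residue_class (0 :: (3 \<Rightarrow>\<^sub>0 nat) \<Rightarrow>\<^sub>0 'k::field)"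
proof -
  have "residue_class 0 = residue_class 0 \<oplus>\<^bsub>double_line_ring\<^esub> residue_class (0 :: (3 \<Rightarrow>\<^sub>0 nat) \<Rightarrow>\<^sub>0 'k)"
    by (simp add: residue_class_add)
  then show ?thesis
    using dl.add.l_cancel_one'[OF residue_class_closed residue_class_closed] by metis
qed

lemma residue_class_neg: "\<ominus>\<^bsub>double_line_ring\<^esub> residue_class f = residue_class (- f)"
  by (rule dl.minus_equality) (simp_all add: residue_class_add residue_class_closed residue_class_zero)

lemma carrier_double_line: "carrier double_line_ring = range residue_class"
  by (auto simp: double_line_ring_def quotient_algebra_def FactRing_def A_RCOSETS_def RCOSETS_def
      residue_class_def a_r_coset_def polynomial_algebra_def)

lemma hcomp_double_line: "hcomp double_line_ring n = residue_class ` hcomp polynomial_algebra n"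
  by (simp add: double_line_ring_def quotient_algebra_def residue_class_def[abs_def])

lemma scal_double_line: "scal double_line_ring c = residue_class (Poly_Mapping.single 0 c)"
  by (simp add: double_line_ring_def quotient_algebra_def residue_class_def polynomial_algebra_def)

text \<open>
  The prime ideal generated by the nilpotent coordinate, which is the generic point of the line.
\<close>

definition generic_point :: "((3 \<Rightarrow>\<^sub>0 nat) \<Rightarrow>\<^sub>0 'k::field) set set" where
  "generic_point = genideal double_line_ring {residue_class x\<^sub>1}"

lemma mem_generic_point:
  fixes f :: "(3 \<Rightarrow>\<^sub>0 nat) \<Rightarrow>\<^sub>0 'k::field"
  shows "residue_class f \<in> generic_point \<longleftrightarrow> x\<^sub>1 dvd f"
proof -
  have gen: "(generic_point :: ((3 \<Rightarrow>\<^sub>0 nat) \<Rightarrow>\<^sub>0 'k) set set) = cgenideal double_line_ring (residue_class x\<^sub>1)"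
    unfolding generic_point_def by (rule dl.cgenideal_eq_genideal[OF residue_class_closed, symmetric])
  have "residue_class f \<in> generic_point \<longleftrightarrow> (\<exists>q. residue_class f = residue_class q \<otimes>\<^bsub>double_line_ring\<^esub> residue_class x\<^sub>1)"
    unfolding gen cgenideal_def carrier_double_line by blast
  also have "\<dots> \<longleftrightarrow> (\<exists>q. residue_class f = residue_class (q * x\<^sub>1))"
    by (simp only: residue_class_mult)
  also have "\<dots> \<longleftrightarrow> x\<^sub>1 dvd f"
  proof
    assume "\<exists>q. residue_class f = residue_class (q * x\<^sub>1)"
    then obtain q :: "(3 \<Rightarrow>\<^sub>0 nat) \<Rightarrow>\<^sub>0 'k" where "x\<^sub>1\<^sup>2 dvd f - q * x\<^sub>1" by (auto simp: residue_class_eq_iff)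
    then have "x\<^sub>1 dvd f - q * x\<^sub>1"
      by (rule dvd_trans[rotated]) (simp add: power2_eq_square)
    then have "x\<^sub>1 dvd (f - q * x\<^sub>1) + q * x\<^sub>1" by (rule dvd_add) simp
    then show "x\<^sub>1 dvd f" by simp
  next
    assume "x\<^sub>1 dvd f"
    then obtain q where "f = x\<^sub>1 * q" ..
    then show "\<exists>q. residue_class f = residue_class (q * x\<^sub>1)" by (auto simp: mult.commute)
  qed
  finally show ?thesis .
qed

lemma poly_var_hcomp: "residue_class (poly_var i) \<in> hcomp double_line_ring 1"
  unfolding hcomp_double_line
  by (rule imageI) (simp add: hcomp_polynomial_algebra poly_var_def monomial_degree_single)

lemma not_x1_dvd: "\<not> (x\<^sub>1 :: (3 \<Rightarrow>\<^sub>0 nat) \<Rightarrow>\<^sub>0 'k::field) dvd 1" "\<not> x\<^sub>1 dvd (poly_var 0 :: _ \<Rightarrow>\<^sub>0 'k)"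
  unfolding x1_dvd_iff by (simp_all add: poly_var_def lookup_single)

lemma generic_point_Proj:
  "(generic_point :: ((3 \<Rightarrow>\<^sub>0 nat) \<Rightarrow>\<^sub>0 'k::field) set set) \<in> Proj double_line_ring"
proof -
  have "ideal (generic_point :: ((3 \<Rightarrow>\<^sub>0 nat) \<Rightarrow>\<^sub>0 'k) set set) double_line_ring"
    unfolding generic_point_def using residue_class_closed by (intro dl.genideal_ideal) simp
  moreover have "carrier double_line_ring \<noteq> (generic_point :: ((3 \<Rightarrow>\<^sub>0 nat) \<Rightarrow>\<^sub>0 'k) set set)"
    using mem_generic_point[of "1 :: (3 \<Rightarrow>\<^sub>0 nat) \<Rightarrow>\<^sub>0 'k"] not_x1_dvd(1) residue_class_closed by blast
  ultimately have "primeideal (generic_point :: ((3 \<Rightarrow>\<^sub>0 nat) \<Rightarrow>\<^sub>0 'k) set set) double_line_ring"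
    by (rule primeidealI[OF _ dl.cring_axioms])
      (auto simp: carrier_double_line residue_class_mult mem_generic_point dest: x1_prime)
  moreover have "homogeneous_ideal double_line_ring (generic_point :: ((3 \<Rightarrow>\<^sub>0 nat) \<Rightarrow>\<^sub>0 'k) set set)"
    using dl.homogeneousI[OF poly_var_hcomp]
    by (intro dl.homogeneous_idealI[OF _ generic_point_def]) simp
  moreover have "\<not> irrelevant_ideal double_line_ring \<subseteq> (generic_point :: ((3 \<Rightarrow>\<^sub>0 nat) \<Rightarrow>\<^sub>0 'k) set set)"
  proof -
    have "(\<Union>d\<in>{0<..}. hcomp double_line_ring d) \<subseteq> carrier double_line_ring"
      using dl.hcomp_carrier by blast
    from dl.genideal_self[OF this] have "residue_class (poly_var 0) \<in> irrelevant_ideal double_line_ring"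
      unfolding irrelevant_ideal_def by (rule subsetD) (rule UN_I[of 1], simp, rule poly_var_hcomp)
    then show ?thesis
      using mem_generic_point not_x1_dvd(2) by blast
  qed
  ultimately show ?thesis by (simp add: Proj_def)
qed

text \<open>
  Forms on the double line are determined by the sections they define, even by the germs at the
  generic point. Denominators there are not divisible by \<open>x\<^sub>1\<close>, so they can be cancelled modulo
  \<open>x\<^sub>1\<^sup>2\<close>. In particular nonzero nilpotent forms define nonzero sections.
\<close>

lemma global_section_residue_class_inject:
  fixes f g :: "(3 \<Rightarrow>\<^sub>0 nat) \<Rightarrow>\<^sub>0 'k::field"
  assumes "dl.global_section (residue_class f) = dl.global_section (residue_class g)"
  shows "x\<^sub>1\<^sup>2 dvd f - g"
proof -
  let ?P = "generic_point :: ((3 \<Rightarrow>\<^sub>0 nat) \<Rightarrow>\<^sub>0 'k) set set"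
  have P: "?P \<in> Proj double_line_ring" by (rule generic_point_Proj)
  interpret localization_data "double_line_ring" "homogeneous double_line_ring - ?P"
    by (rule dl.Proj_localization_data[OF P])
  have "dl.germ ?P (residue_class f) (residue_class 1) = dl.germ ?P (residue_class g) (residue_class 1)"
    using fun_cong[OF assms, of ?P] P
    by (simp add: dl.global_section_def residue_class_one)
  then obtain u where u: "u \<in> homogeneous double_line_ring - ?P"
      "u \<otimes>\<^bsub>double_line_ring\<^esub> (residue_class f \<otimes>\<^bsub>double_line_ring\<^esub> residue_class 1)
        = u \<otimes>\<^bsub>double_line_ring\<^esub> (residue_class g \<otimes>\<^bsub>double_line_ring\<^esub> residue_class 1)"
    using fraction_eq_iff[of "residue_class f" "residue_class 1" "residue_class g" "residue_class 1"] one_closed residue_class_closed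
    by (auto simp: residue_class_one)
  then obtain U where U: "u = residue_class U"
    using dl.homogeneous_carrier carrier_double_line by blast
  have "x\<^sub>1\<^sup>2 dvd U * (f - g)"
    using u(2) unfolding U by (simp add: residue_class_mult residue_class_eq_iff right_diff_distrib)
  moreover have "\<not> x\<^sub>1 dvd U"
    using u(1) unfolding U by (simp add: mem_generic_point)
  ultimately show ?thesis by (rule x1_square_dvd_mult_cancel)
qed

section \<open>A square-zero graded linear series with prescribed dimensions\<close>

text \<open>
  The exponent of \<open>x\<^sub>0\<^sup>i x\<^sub>1 x\<^sub>2\<^sup>m\<close> with \<open>m = 2 n - 1 - i\<close>. For \<open>i < 2 n\<close> the subtraction does not truncate, and
  these are the \<open>2 n\<close> monomials of degree \<open>2 n\<close> that are nilpotent but nonzero on the double line.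
\<close>

definition nilpotent_monomial :: "nat \<Rightarrow> nat \<Rightarrow> 3 \<Rightarrow>\<^sub>0 nat" where
  "nilpotent_monomial n i =
    Poly_Mapping.single 0 i + Poly_Mapping.single 1 1 + Poly_Mapping.single 2 (2 * n - 1 - i)"

lemma lookup_nilpotent_monomial: "Poly_Mapping.lookup (nilpotent_monomial n i) 0 = i"
    "Poly_Mapping.lookup (nilpotent_monomial n i) 1 = 1"
  by (simp_all add: nilpotent_monomial_def lookup_add lookup_single when_def)

lemma monomial_degree_nilpotent: "i < 2 * n \<Longrightarrow> monomial_degree (nilpotent_monomial n i) = 2 * n"
  by (simp add: nilpotent_monomial_def monomial_degree_add monomial_degree_single)

definition nilpotent_span :: "nat \<Rightarrow> nat \<Rightarrow> ((3 \<Rightarrow>\<^sub>0 nat) \<Rightarrow>\<^sub>0 'k::field) set set" where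
  "nilpotent_span n j = residue_class ` {f. Poly_Mapping.keys f \<subseteq> nilpotent_monomial n ` {..<j}}"

text \<open>
  The monomials are added one at a time. A new one is not in the span of the earlier ones: the
  difference would be divisible by \<open>x\<^sub>1\<^sup>2\<close>, whereas it contains a monomial that is linear in \<open>x\<^sub>1\<close>.
\<close>

lemma has_dim_nilpotent_span:
  assumes "r \<le> 2 * n"
  shows "has_dim (section_algebra (double_line_ring :: ('k::field, _) graded_algebra) 2)
    (dl.homogeneous_section n ` nilpotent_span n r) r"
proof (rule dl.has_dim_chain[where E = "nilpotent_span n" and
      w = "\<lambda>j. residue_class (Poly_Mapping.single (nilpotent_monomial n j) 1)"])
  show "nilpotent_span n 0 = {\<zero>\<^bsub>double_line_ring\<^esub> :: ((3 \<Rightarrow>\<^sub>0 nat) \<Rightarrow>\<^sub>0 'k) set}"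
    by (auto simp: nilpotent_span_def residue_class_zero)
next
  fix j assume j: "j < r"
  let ?e = "nilpotent_monomial n j"
  show "residue_class (Poly_Mapping.single ?e (1 :: 'k)) \<in> hcomp double_line_ring (2 * n)"
    unfolding hcomp_double_line using j assms
    by (intro imageI) (simp add: hcomp_polynomial_algebra monomial_degree_nilpotent)
  have scal_w: "scal double_line_ring c \<otimes>\<^bsub>double_line_ring\<^esub> residue_class (Poly_Mapping.single ?e (1 :: 'k))
      \<oplus>\<^bsub>double_line_ring\<^esub> residue_class f = residue_class (Poly_Mapping.single ?e c + f)" for c f
    by (simp add: scal_double_line residue_class_mult residue_class_add mult_single)
  show "nilpotent_span n (Suc j) = {scal double_line_ring c
      \<otimes>\<^bsub>double_line_ring\<^esub> residue_class (Poly_Mapping.single ?e (1 :: 'k)) \<oplus>\<^bsub>double_line_ring\<^esub> v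
      | c v. v \<in> nilpotent_span n j}" (is "_ = ?rhs")
  proof (intro equalityI subsetI)
    fix v :: "((3 \<Rightarrow>\<^sub>0 nat) \<Rightarrow>\<^sub>0 'k) set"
    assume "v \<in> nilpotent_span n (Suc j)"
    then obtain f where f: "Poly_Mapping.keys f \<subseteq> nilpotent_monomial n ` {..<Suc j}" "v = residue_class f"
      by (auto simp: nilpotent_span_def)
    \<comment> \<open>Split off the monomial that is added at this stage.\<close>
    define g where "g = f - Poly_Mapping.single ?e (Poly_Mapping.lookup f ?e)"
    have "Poly_Mapping.keys g \<subseteq> Poly_Mapping.keys f - {?e}"
      by (auto simp: g_def in_keys_iff lookup_minus lookup_single when_def split: if_splits)
    then have "residue_class g \<in> nilpotent_span n j"
      using f(1) unfolding nilpotent_span_def by (intro imageI) (auto simp: lessThan_Suc)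
    moreover have "v = scal double_line_ring (Poly_Mapping.lookup f ?e)
        \<otimes>\<^bsub>double_line_ring\<^esub> residue_class (Poly_Mapping.single ?e 1) \<oplus>\<^bsub>double_line_ring\<^esub> residue_class g"
      unfolding scal_w f(2) g_def by simp
    ultimately show "v \<in> ?rhs" by blast
  next
    fix v assume "v \<in> ?rhs"
    then obtain c g where g: "Poly_Mapping.keys g \<subseteq> nilpotent_monomial n ` {..<j}"
        "v = residue_class (Poly_Mapping.single ?e c + g)"
      unfolding nilpotent_span_def using scal_w by blast
    have "Poly_Mapping.keys (Poly_Mapping.single ?e c + g) \<subseteq> nilpotent_monomial n ` {..<Suc j}"
      using keys_add[of "Poly_Mapping.single ?e c" g] g(1)
      by (auto simp: lessThan_Suc split: if_splits)
    then show "v \<in> nilpotent_span n (Suc j)"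
      unfolding nilpotent_span_def g(2) by (intro imageI) simp
  qed
  show "dl.global_section (residue_class (Poly_Mapping.single ?e (1 :: 'k)))
      \<notin> dl.global_section ` nilpotent_span n j"
  proof
    assume "dl.global_section (residue_class (Poly_Mapping.single ?e (1 :: 'k)))
      \<in> dl.global_section ` nilpotent_span n j"
    then obtain f where f: "Poly_Mapping.keys f \<subseteq> nilpotent_monomial n ` {..<j}"
        "x\<^sub>1\<^sup>2 dvd Poly_Mapping.single ?e (1 :: 'k) - f"
      unfolding nilpotent_span_def using global_section_residue_class_inject by blast
    have "?e \<notin> nilpotent_monomial n ` {..<j}"
      using lookup_nilpotent_monomial(1) by (metis imageE lessThan_iff less_irrefl)
    then have "Poly_Mapping.lookup f ?e = 0"
      using f(1) by (meson in_keys_iff subsetD)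
    then have "?e \<in> Poly_Mapping.keys (Poly_Mapping.single ?e (1 :: 'k) - f)"
      by (simp add: in_keys_iff lookup_minus)
    then have "2 \<le> Poly_Mapping.lookup ?e 1"
      by (rule x1_square_dvd[OF f(2)])
    then show False by (simp add: lookup_nilpotent_monomial)
  qed
qed

text \<open>
  Take the constants in degree \<open>0\<close> and, in degree \<open>n > 0\<close>, the span of the first \<open>\<delta> n\<close> of the \<open>2 n\<close>
  nilpotent monomials. Products of elements of positive degree are divisible by \<open>x\<^sub>1\<^sup>2\<close> and vanish, so these
  spaces form a subalgebra no matter how the dimensions \<open>\<delta> n\<close> are chosen.
\<close>

lemma square_zero_series_exists:
  fixes \<delta> :: "nat \<Rightarrow> nat"
  assumes \<delta>: "\<And>n. n > 0 \<Longrightarrow> \<delta> n \<le> 2 * n"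
  defines "S \<equiv> (double_line_ring :: ('k::field, ((3 \<Rightarrow>\<^sub>0 nat) \<Rightarrow>\<^sub>0 'k) set) graded_algebra)"
  defines "A \<equiv> section_algebra S 2"
  shows "\<exists>L. graded_linear_series S 2 L \<and> (\<forall>n>0. has_dim A (L \<inter> hcomp A n) (\<delta> n)) \<and>
    kodaira_iitaka_dim A L = - \<infinity>"
proof -
  define exps where "exps n = (if n = 0 then {0} else nilpotent_monomial n ` {..<\<delta> n})" for n
  define B :: "nat \<Rightarrow> ((3 \<Rightarrow>\<^sub>0 nat) \<Rightarrow>\<^sub>0 'k) set set"
    where "B n = residue_class ` {f. Poly_Mapping.keys f \<subseteq> exps n}" for n
  have B_I: "residue_class f \<in> B n" if "Poly_Mapping.keys f \<subseteq> exps n" for f n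
    using that unfolding B_def by blast
  have B_pos: "B n = nilpotent_span n (\<delta> n)" if "n > 0" for n
    using that by (simp add: B_def nilpotent_span_def exps_def)
  have degree: "monomial_degree e = 2 * n" if "e \<in> exps n" for e n
    using that \<delta>[of n] monomial_degree_nilpotent[of _ n]
    by (fastforce simp: exps_def monomial_degree_def split: if_splits)
  have hcomp: "B n \<subseteq> hcomp double_line_ring (2 * n)" for n
    unfolding B_def hcomp_double_line
    by (intro image_mono subsetI) (auto simp: hcomp_polynomial_algebra intro!: degree)
  have zero: "\<zero>\<^bsub>double_line_ring\<^esub> \<in> B n" for n
    unfolding residue_class_zero by (rule B_I) simp
  have prod_zero: "a \<otimes>\<^bsub>double_line_ring\<^esub> b = \<zero>\<^bsub>double_line_ring\<^esub>"
    if ab: "a \<in> B m" "b \<in> B n" and mn: "m > 0" "n > 0" for a b m n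
  proof -
    obtain f g where f: "a = residue_class f" "Poly_Mapping.keys f \<subseteq> exps m"
      and g: "b = residue_class g" "Poly_Mapping.keys g \<subseteq> exps n"
      using ab by (auto simp: B_def)
    have "x\<^sub>1 dvd f" "x\<^sub>1 dvd g"
      using f(2) g(2) mn lookup_nilpotent_monomial(2)
      by (fastforce simp: x1_dvd_iff exps_def)+
    then have "x\<^sub>1\<^sup>2 dvd f * g"
      unfolding power2_eq_square by (rule mult_dvd_mono)
    then show ?thesis
      unfolding f(1) g(1) residue_class_mult residue_class_zero residue_class_eq_iff by simp
  qed
  have add: "a \<oplus>\<^bsub>double_line_ring\<^esub> b \<in> B n" if ab: "a \<in> B n" "b \<in> B n" for a b n
  proof -
    obtain f g where "a = residue_class f" "Poly_Mapping.keys f \<subseteq> exps n"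
      and "b = residue_class g" "Poly_Mapping.keys g \<subseteq> exps n"
      using ab by (auto simp: B_def)
    then show ?thesis using keys_add[of f g] by (auto simp: residue_class_add intro!: B_I)
  qed
  have neg: "\<ominus>\<^bsub>double_line_ring\<^esub> a \<in> B n" if a: "a \<in> B n" for a n
  proof -
    obtain f where f: "a = residue_class f" "Poly_Mapping.keys f \<subseteq> exps n"
      using a by (auto simp: B_def)
    have "Poly_Mapping.keys (- f) = Poly_Mapping.keys f" by (auto simp: in_keys_iff)
    then show ?thesis using f by (auto simp: residue_class_neg intro!: B_I)
  qed
  have mult: "a \<otimes>\<^bsub>double_line_ring\<^esub> b \<in> B (m + n)" if ab: "a \<in> B m" "b \<in> B n" for a b m n
  proof (cases "m = 0 \<or> n = 0")
    case True
    obtain f g where fg: "a = residue_class f" "Poly_Mapping.keys f \<subseteq> exps m"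
        "b = residue_class g" "Poly_Mapping.keys g \<subseteq> exps n"
      using ab by (auto simp: B_def)
    have "Poly_Mapping.keys (f * g) \<subseteq> exps (m + n)"
      using True keys_mult[of f g] fg(2,4) by (fastforce simp: exps_def split: if_splits)
    then show ?thesis unfolding fg residue_class_mult by (rule B_I)
  next
    case False
    then show ?thesis using prod_zero[OF ab] zero by simp
  qed
  have scal: "scal double_line_ring c \<in> B 0" for c
    unfolding scal_double_line by (rule B_I) (simp add: exps_def)
  note B = hcomp zero add neg mult scal
  let ?L = "dl.series_of 2 B"
  have L_hcomp: "?L \<inter> hcomp A n = dl.homogeneous_section n ` B n" for n
    unfolding A_def S_def by (rule dl.series_of_hcomp[OF B])
  have "graded_linear_series S 2 ?L"
    unfolding S_def by (rule dl.graded_linear_series_of[OF B])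
  moreover have "has_dim A (?L \<inter> hcomp A n) (\<delta> n)" if "n > 0" for n
    unfolding L_hcomp B_pos[OF that] unfolding A_def S_def
    by (rule has_dim_nilpotent_span[OF \<delta>[OF that]])
  moreover have "kodaira_iitaka_dim A ?L = - \<infinity>"
  proof (rule kodaira_iitaka_dim_nilpotent)
    show "cring A" unfolding A_def S_def by (rule dl.cring_section_algebra)
    show "scal A c \<in> carrier A" for c
      unfolding A_def S_def dl.scal_eq_homogeneous_section
      by (rule dl.homogeneous_section_carrier) (simp add: dl.scal_hcomp)
  next
    fix n y assume n: "n > 0" and "y \<in> ?L \<inter> hcomp A n"
    then obtain a where a: "a \<in> B n" "y = dl.homogeneous_section n a"
      unfolding L_hcomp by blast
    then have ah: "a \<in> hcomp double_line_ring (2 * n)" using hcomp by blast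
    have "y \<otimes>\<^bsub>A\<^esub> y = dl.homogeneous_section (n + n) \<zero>\<^bsub>double_line_ring\<^esub>"
      unfolding A_def S_def a(2) dl.homogeneous_section_mult[OF ah ah] prod_zero[OF a(1) a(1) n n] ..
    also have "\<dots> = \<zero>\<^bsub>A\<^esub>"
      unfolding A_def S_def by (rule dl.homogeneous_section_zero)
    finally show "y \<in> carrier A \<and> y \<otimes>\<^bsub>A\<^esub> y = \<zero>\<^bsub>A\<^esub>"
      using dl.homogeneous_section_carrier[OF ah] unfolding A_def S_def a(2) by blast
  qed
  ultimately show ?thesis by blast
qed

theorem theorem12p2:
  fixes T :: "nat set"
  assumes "T \<subseteq> {0<..}" and "infinite T" and "infinite ({0<..} - T)"
  defines "S \<equiv> (double_line_ring :: ('k::field, ((3 \<Rightarrow>\<^sub>0 nat) \<Rightarrow>\<^sub>0 'k) set) graded_algebra)"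
  defines "A \<equiv> section_algebra S 2"
  shows "\<exists>L. graded_linear_series S 2 L \<and>
           (\<forall>n>0. has_dim A (L \<inter> hcomp A n)
              (if n \<in> T then nat \<lceil>ln (real n)\<rceil> else nat \<lceil>ln (real n) / 2\<rceil>)) \<and>
           kodaira_iitaka_dim A L = - \<infinity>"
proof -
  have "(if n \<in> T then nat \<lceil>ln (real n)\<rceil> else nat \<lceil>ln (real n) / 2\<rceil>) \<le> 2 * n" if "n > 0" for n
  proof -
    have "0 \<le> ln (real n)" "ln (real n) \<le> real n"
      using that ln_le_minus_one[of "real n"] by auto
    then have "nat \<lceil>ln (real n)\<rceil> \<le> 2 * n" "nat \<lceil>ln (real n) / 2\<rceil> \<le> 2 * n"
      by (simp_all add: nat_le_iff ceiling_le_iff)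
    then show ?thesis by simp
  qed
  then show ?thesis
    unfolding A_def S_def by (rule square_zero_series_exists)
qed

end
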